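(* Let $k\ge 1$, let $1<m_1<m_2<\cdots<m_k$ be distinct positive integers, and let $a_1,\dots,a_k$ be integers such that every integer $z$ satisfies $z\equiv a_j \pmod{m_j}$ for at least one $j\in\{1,\dots,k\}$ (i.e. the congruences form a distinct covering system). Then $m_1\le 10^{18}$. *)

theory Defs
  imports Complex_Main "HOL-Number_Theory.Cong"
begin

end

theory Submission
  imports Defs "HOL-Computational_Algebra.Primes" "HOL-Number_Theory.Totient"
begin

text \<open>
  This is the distortion method of Balister, Bollobas, Morris, Sahasrabudhe and Tiba. Assume that all moduli exceed
  \<open>10 ^ 18\<close> and put \<open>y = 6299\<close>. Reveal the residue of a random integer one prime at a time, in increasing order. Up to
  \<open>y\<close> the measure is uniform, and the classes whose moduli are \<open>y\<close>-smooth have total mass at most \<open>\<Sum> 1 / d\<close> over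
  smooth \<open>d > 10 ^ 18\<close>, which is small by Rankin's trick. At a prime \<open>p > y\<close> the conditional measure on each fibre is
  distorted to avoid the classes whose moduli have largest prime factor \<open>p\<close>, while densities grow by a factor at most
  \<open>1 / (1 - \<delta>)\<close>. As \<open>max 0 (\<alpha> - \<delta>) \<le> \<alpha>\<^sup>2 / (4 * \<delta>)\<close>, the mass that these classes retain is controlled by the second
  moment of the proportion \<open>\<alpha>\<close> of the fibre that they fill, and since the moduli are distinct that moment is at most
  \<open>1 / (p - 1)\<^sup>2\<close> times an Euler product over the primes below \<open>p\<close>. With \<open>\<delta> = 1/6\<close> all these masses add up to less than
  1, so some integer is uncovered.
\<close>

section \<open>Averages of periodic functions\<close>

definition periodic :: "nat \<Rightarrow> (int \<Rightarrow> real) \<Rightarrow> bool" where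
  "periodic N h \<longleftrightarrow> (\<forall>x. h (x + int N) = h x)"

lemma periodic_shift:
  assumes "periodic N h"
  shows "h (x + int N * t) = h x"
proof -
  have nat: "h (x + int N * int j) = h x" for x j
  proof (induction j)
    case (Suc j)
    have "h (x + int N * int (Suc j)) = h ((x + int N * int j) + int N)"
      by (simp add: algebra_simps)
    with Suc assms show ?case by (simp add: periodic_def)
  qed simp
  show ?thesis
  proof (cases "t \<ge> 0")
    case True
    then show ?thesis using nat[of x "nat t"] by simp
  next
    case False
    then have "x = (x + int N * t) + int N * int (nat (- t))" by simp
    then show ?thesis using nat[of "x + int N * t" "nat (- t)"] by metis
  qed
qed

lemma periodic_mod:
  assumes "periodic N h"
  shows "h (x mod int N) = h x"
  using periodic_shift[OF assms, of "x mod int N" "x div int N"] by simp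

lemma periodic_dvd:
  assumes "periodic N h" "N dvd M"
  shows "periodic M h"
  using assms periodic_shift[OF assms(1)] by (auto simp: periodic_def elim!: dvdE)

lemma periodic_mult: "periodic N g \<Longrightarrow> periodic N h \<Longrightarrow> periodic N (\<lambda>x. g x * h x)"
  by (simp add: periodic_def)

section \<open>Indicators of residue classes\<close>

definition residue_ind :: "int \<Rightarrow> nat \<Rightarrow> int \<Rightarrow> real" where
  "residue_ind a d x = of_bool [x = a] (mod int d)"

lemma periodic_residue_ind: "d dvd N \<Longrightarrow> periodic N (residue_ind a d)"
proof (rule periodic_dvd)
  show "periodic d (residue_ind a d)" by (auto simp: periodic_def residue_ind_def cong_def)
qed

lemma residue_ind_nonneg: "0 \<le> residue_ind a d x" by (simp add: residue_ind_def)

lemma residue_ind_mult: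
  assumes "coprime m e"
  shows "residue_ind a (m * e) x = residue_ind a m x * residue_ind a e x"
proof -
  have "[x = a] (mod int m * int e) \<longleftrightarrow> [x = a] (mod int m) \<and> [x = a] (mod int e)"
    using assms by (metis coprime_cong_mult cong_modulus_mult coprime_int_iff mult.commute)
  then show ?thesis by (simp add: residue_ind_def)
qed

text \<open>\<open>K\<close> is invertible modulo \<open>e\<close>, so the map is injective, and an
  injective self-map of a finite set is onto. The case \<open>K = 1\<close> yields shift invariance
  of averages, the general case independence along fibres.\<close>

lemma bij_betw_affine_mod:
  fixes K e :: nat
  assumes "coprime K e" "e > 0"
  shows "bij_betw (\<lambda>t. nat ((x + int K * int t) mod int e)) {..<e} {..<e}"
proof -
  let ?g = "\<lambda>t. nat ((x + int K * int t) mod int e)"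
  have inj: "inj_on ?g {..<e}"
  proof (rule inj_onI)
    fix s t assume *: "s \<in> {..<e}" "t \<in> {..<e}" "?g s = ?g t"
    then have "(x + int K * int s) mod int e = (x + int K * int t) mod int e"
      using assms by (simp add: eq_nat_nat_iff)
    then have "[x + int K * int s = x + int K * int t] (mod int e)" by (simp add: cong_def)
    then have "[int K * int s = int K * int t] (mod int e)" by (simp add: cong_add_lcancel)
    moreover have "coprime (int K) (int e)" using assms by simp
    ultimately have "[int s = int t] (mod int e)" by (simp add: cong_mult_lcancel)
    then have "[s = t] (mod e)" by (simp add: cong_int_iff)
    then show "s = t" using * by (simp add: cong_def)
  qed
  moreover have "?g ` {..<e} \<subseteq> {..<e}" using assms by (auto simp: nat_less_iff)
  ultimately show ?thesis by (simp add: bij_betw_def endo_inj_surj)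
qed

lemma sum_residue_ind_affine:
  fixes K e c :: nat
  assumes "coprime K e" "e > 0"
  shows "(\<Sum>t<c * e. residue_ind a e (x + int (K * t))) = real c"
proof -
  let ?h = "\<lambda>t. residue_ind a e (x + int (K * t))"
  have per: "?h (t + j * e) = ?h t" for t j
    using periodic_shift[OF periodic_residue_ind[of e e a, OF dvd_refl], of "x + int (K * t)" "int (K * j)"]
    by (simp add: algebra_simps)
  have one: "(\<Sum>t<e. ?h t) = 1"
  proof -
    have "(\<Sum>t<e. ?h t) = (\<Sum>t<e. residue_ind a e (int (nat ((x + int K * int t) mod int e))))"
      using periodic_mod[OF periodic_residue_ind[of e e a, OF dvd_refl]] assms by simp
    also have "\<dots> = (\<Sum>t<e. residue_ind a e (int t))"
      by (rule sum.reindex_bij_betw[OF bij_betw_affine_mod[OF assms], of "\<lambda>t. residue_ind a e (int t)"])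
    also have "\<dots> = (\<Sum>t<e. if t = nat (a mod int e) then 1 else 0)"
    proof (rule sum.cong[OF refl])
      fix t assume "t \<in> {..<e}"
      then have "[int t = a] (mod int e) \<longleftrightarrow> t = nat (a mod int e)"
        using assms by (auto simp: cong_def)
      then show "residue_ind a e (int t) = (if t = nat (a mod int e) then 1 else 0)"
        by (simp add: residue_ind_def)
    qed
    also have "\<dots> = 1" using assms by (simp add: nat_less_iff)
    finally show ?thesis .
  qed
  have "(\<Sum>t<c * e. ?h t) = (\<Sum>j<c. sum ?h {j * e..<j * e + e})"
    by (rule sum.nat_group[symmetric])
  also have "\<dots> = (\<Sum>j<c. \<Sum>t<e. ?h (t + j * e))"
  proof (rule sum.cong[OF refl])
    fix j
    show "sum ?h {j * e..<j * e + e} = (\<Sum>t<e. ?h (t + j * e))"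
      using sum.shift_bounds_nat_ivl[of ?h 0 "j * e" e]
      by (simp only: add_0 atLeast0LessThan add.commute[of e])
  qed
  also have "\<dots> = real c" by (simp only: per one) simp
  finally show ?thesis .
qed

definition avg :: "nat \<Rightarrow> (int \<Rightarrow> real) \<Rightarrow> real" where
  "avg N h = (\<Sum>x<N. h (int x)) / real N"

lemma avg_mono: "(\<And>x. g x \<le> h x) \<Longrightarrow> avg N g \<le> avg N h"
  by (simp add: avg_def divide_right_mono sum_mono)

lemma avg_add: "avg N (\<lambda>x. g x + h x) = avg N g + avg N h"
  by (simp add: avg_def sum.distrib add_divide_distrib)

lemma avg_cmult: "avg N (\<lambda>x. c * h x) = c * avg N h"
  by (simp add: avg_def sum_distrib_left)

lemma avg_sum: "avg N (\<lambda>x. \<Sum>i\<in>I. h i x) = (\<Sum>i\<in>I. avg N (h i))"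
  unfolding avg_def by (subst sum.swap) (simp add: sum_divide_distrib)

lemma avg_residue_ind:
  assumes "d dvd N" "N > 0"
  shows "avg N (residue_ind a d) = 1 / real d"
proof -
  from assms obtain c where c: "N = c * d" "d > 0" "c > 0" by (auto elim!: dvdE)
  then show ?thesis using sum_residue_ind_affine[of 1 d a 0 c] by (simp add: avg_def)
qed

lemma avg_shift:
  assumes "periodic N h" "N > 0"
  shows "avg N (\<lambda>x. h (x + y)) = avg N h"
proof -
  have "(\<Sum>x<N. h (int x + y)) = (\<Sum>x<N. h (int (nat ((y + int 1 * int x) mod int N))))"
    using assms periodic_mod[OF assms(1)] by (simp add: add.commute)
  also have "\<dots> = (\<Sum>x<N. h (int x))"
    using assms by (intro sum.reindex_bij_betw[of _ _ _ "\<lambda>t. h (int t)"] bij_betw_affine_mod) auto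
  finally show ?thesis by (simp add: avg_def)
qed

section \<open>Conditional averages over the residues modulo \<open>K * P\<close> above a residue
  modulo \<open>K\<close>\<close>

definition fibre_avg :: "nat \<Rightarrow> nat \<Rightarrow> (int \<Rightarrow> real) \<Rightarrow> int \<Rightarrow> real" where
  "fibre_avg K P h x = (\<Sum>t<P. h (x + int (K * t))) / real P"

lemma fibre_avg_mult:
  assumes "periodic K u"
  shows "fibre_avg K P (\<lambda>x. u x * h x) x = u x * fibre_avg K P h x"
  using periodic_shift[OF assms] by (simp add: fibre_avg_def sum_distrib_left)

lemma fibre_avg_mono: "(\<And>x. g x \<le> h x) \<Longrightarrow> fibre_avg K P g x \<le> fibre_avg K P h x"
  by (simp add: fibre_avg_def divide_right_mono sum_mono)

lemma fibre_avg_const: "P > 0 \<Longrightarrow> fibre_avg K P (\<lambda>x. c) x = c"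
  by (simp add: fibre_avg_def)

lemma fibre_avg_sum: "fibre_avg K P (\<lambda>x. \<Sum>i\<in>I. h i x) x = (\<Sum>i\<in>I. fibre_avg K P (h i) x)"
  unfolding fibre_avg_def by (subst sum.swap) (simp add: sum_divide_distrib)

text \<open>Law of total expectation: by shift invariance each of the \<open>P\<close> translates of
  \<open>h\<close> has the same average.\<close>

lemma avg_fibre_avg:
  assumes "periodic N h" "N > 0" "P > 0"
  shows "avg N (fibre_avg K P h) = avg N h"
proof -
  have "avg N (fibre_avg K P h) = avg N (\<lambda>x. (1 / real P) * (\<Sum>t<P. h (x + int (K * t))))"
    by (simp add: fibre_avg_def[abs_def])
  also have "\<dots> = (1 / real P) * (\<Sum>t<P. avg N h)"
    using avg_shift[OF assms(1,2)] by (simp only: avg_cmult avg_sum)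
  finally show ?thesis using assms by simp
qed

text \<open>A shift by \<open>K\<close> moves \<open>t\<close> to \<open>t + 1\<close>; the term
  lost at \<open>t = 0\<close> equals the one gained at \<open>t = P\<close>, because
  \<open>h\<close> has period \<open>K * P\<close>.\<close>

lemma periodic_fibre_avg:
  assumes "periodic (K * P) h"
  shows "periodic K (fibre_avg K P h)"
  unfolding periodic_def
proof
  fix x
  have "(\<Sum>t<P. h (x + int K + int (K * t))) = (\<Sum>t<P. h (x + int (K * Suc t)))"
    by (simp add: algebra_simps)
  also have "\<dots> + h (x + int (K * 0)) = (\<Sum>t<Suc P. h (x + int (K * t)))"
    by (simp only: sum.lessThan_Suc_shift add.commute)
  also have "\<dots> = (\<Sum>t<P. h (x + int (K * t))) + h (x + int (K * 0))"
    using assms by (simp add: periodic_def)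
  finally show "fibre_avg K P h (x + int K) = fibre_avg K P h x" by (simp add: fibre_avg_def)
qed

text \<open>A class modulo a divisor of \<open>P\<close> is independent of the residue modulo
  \<open>K\<close>: the fibre runs through \<open>P / e\<close> full periods modulo \<open>e\<close>
  and meets the class once in each.\<close>

lemma fibre_avg_residue_ind:
  assumes "coprime K P" "e dvd P" "P > 0"
  shows "fibre_avg K P (residue_ind a e) x = 1 / real e"
proof -
  from assms obtain c where c: "P = c * e" "e > 0" "c > 0" by (auto elim!: dvdE)
  moreover have "coprime K e" using assms coprime_divisors dvd_refl by blast
  ultimately show ?thesis
    using sum_residue_ind_affine[of K e a x c] by (simp add: fibre_avg_def)
qed

section \<open>Sums over divisors\<close>

lemma finite_divisors: "N > 0 \<Longrightarrow> finite {d::nat. d dvd N}"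
  by (rule finite_subset[of _ "{..N}"]) (auto dest: dvd_imp_le)

lemma gcd_mult_coprime_divisor:
  fixes K P m e :: nat
  assumes "coprime K P" "m dvd K" "e dvd P"
  shows "gcd (m * e) K = m" "gcd (m * e) P = e"
proof -
  have "coprime K e" using assms coprime_divisors dvd_refl by blast
  then show "gcd (m * e) K = m"
    using assms by (metis gcd_mult_left_right_cancel gcd_nat.absorb1 coprime_commute)
  have "coprime m P" using assms coprime_divisors dvd_refl by blast
  then show "gcd (m * e) P = e"
    using assms by (metis gcd_mult_left_left_cancel gcd_nat.absorb1 coprime_commute)
qed

lemma gcd_mult_gcd_coprime:
  fixes K P d :: nat
  assumes "coprime K P" "d dvd K * P"
  shows "gcd d K * gcd d P = d"
proof -
  obtain m e where "d = m * e" "m dvd K" "e dvd P" using assms(2) by (rule dvd_productE)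
  then show ?thesis using gcd_mult_coprime_divisor[OF assms(1)] by simp
qed

lemma bij_betw_divisors_mult:
  fixes K P :: nat
  assumes "coprime K P"
  shows "bij_betw (\<lambda>(m, e). m * e) ({m. m dvd K} \<times> {e. e dvd P}) {d. d dvd K * P}"
  using gcd_mult_coprime_divisor[OF assms] gcd_mult_gcd_coprime[OF assms]
  by (intro bij_betw_byWitness[where f' = "\<lambda>d. (gcd d K, gcd d P)"]) (auto intro: mult_dvd_mono)

lemma sum_divisors_mult:
  fixes K P :: nat
  assumes "coprime K P"
  shows "(\<Sum>d | d dvd K * P. F d) = (\<Sum>m | m dvd K. \<Sum>e | e dvd P. F (m * e))"
  using sum.reindex_bij_betw[OF bij_betw_divisors_mult[OF assms], of F]
  by (simp add: sum.cartesian_product case_prod_unfold)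

lemma lcm_mult_coprime:
  fixes K P :: nat
  assumes "coprime K P" "m dvd K" "m' dvd K" "e dvd P" "e' dvd P"
  shows "lcm (m * e) (m' * e') = lcm m m' * lcm e e'"
proof (rule dvd_antisym)
  show "lcm (m * e) (m' * e') dvd lcm m m' * lcm e e'"
    by (intro lcm_least mult_dvd_mono dvd_lcm1 dvd_lcm2)
  have "coprime (lcm m m') (lcm e e')"
    using assms coprime_divisors[of "lcm m m'" K "lcm e e'" P] by simp
  moreover have "lcm m m' dvd lcm (m * e) (m' * e')" "lcm e e' dvd lcm (m * e) (m' * e')"
    by (meson dvd_lcmI1 dvd_lcmI2 dvd_triv_left dvd_triv_right lcm_least)+
  ultimately show "lcm m m' * lcm e e' dvd lcm (m * e) (m' * e')"
    by (rule divides_mult[rotated 2])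
qed

lemma sum_divisors_prime_power:
  assumes "prime (p::nat)"
  shows "(\<Sum>e | e dvd p ^ c. F e) = (\<Sum>j\<le>c. F (p ^ j))"
proof -
  have "{e. e dvd p ^ c} = (\<lambda>j. p ^ j) ` {..c}"
    using divides_primepow_nat[OF assms] by auto
  moreover have "inj_on (\<lambda>j. p ^ j) {..c}"
    using prime_gt_1_nat[OF assms] by (auto intro!: inj_onI simp: power_inject_exp)
  ultimately show ?thesis by (simp add: sum.reindex)
qed

lemma sum_power_le: "0 \<le> x \<Longrightarrow> x < 1 \<Longrightarrow> (\<Sum>j\<le>c. x ^ j) \<le> 1 / (1 - x :: real)"
  by (simp add: sum_gp0 divide_right_mono)

text \<open>Exactly \<open>2 * k + 1\<close> pairs have maximum \<open>k\<close>, so the right-hand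
  side is the full series \<open>\<Sum>k. (2 * k + 1) * x ^ k\<close>.\<close>

lemma sum_power_max_le:
  fixes x :: real
  assumes "0 \<le> x" "x < 1"
  shows "(\<Sum>i\<le>c. \<Sum>j\<le>c. x ^ max i j) \<le> (1 + x) / (1 - x)\<^sup>2"
proof -
  define u where "u = 1 - x"
  then have x: "x = 1 - u" and u: "u \<noteq> 0" using assms by auto
  \<comment> \<open>The second summand is the tail of that series beyond \<open>c\<close> in closed
    form. Including it gives an identity that can be proved by induction.\<close>
  have "(\<Sum>i\<le>c. \<Sum>j\<le>c. x ^ max i j) + x ^ Suc c * ((2 * real c + 3) / (1 - x) + 2 * x / (1 - x)\<^sup>2)
     = (1 + x) / (1 - x)\<^sup>2" for c
  proof (induction c)
    case 0
    show ?case using u unfolding x by (simp add: field_simps power2_eq_square)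
  next
    case (Suc c)
    have "(\<Sum>i\<le>c. x ^ max i (Suc c)) = (\<Sum>i\<le>c. x ^ Suc c)" "(\<Sum>i\<le>c. x ^ max (Suc c) i) = (\<Sum>i\<le>c. x ^ Suc c)"
      by (intro sum.cong refl arg_cong[where f = "(^) x"]; simp)+
    then have "(\<Sum>i\<le>Suc c. \<Sum>j\<le>Suc c. x ^ max i j) = (\<Sum>i\<le>c. \<Sum>j\<le>c. x ^ max i j) + (2 * real c + 3) * x ^ Suc c"
      by (simp add: sum.distrib algebra_simps)
    moreover have "(2 * real c + 3) * x ^ Suc c + x ^ Suc (Suc c) * ((2 * real (Suc c) + 3) / (1 - x) + 2 * x / (1 - x)\<^sup>2)
       = x ^ Suc c * ((2 * real c + 3) / (1 - x) + 2 * x / (1 - x)\<^sup>2)"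
    proof -
      have "(2 * real c + 3) + x * ((2 * real (Suc c) + 3) / (1 - x) + 2 * x / (1 - x)\<^sup>2)
         = (2 * real c + 3) / (1 - x) + 2 * x / (1 - x)\<^sup>2"
        using u unfolding x by (simp add: field_simps power2_eq_square)
      moreover have "a * z + x * z * b = z * (a + x * b)" for a b z :: real
        by (simp add: algebra_simps)
      ultimately show ?thesis by (metis power_Suc)
    qed
    ultimately show ?case using Suc.IH by linarith
  qed
  moreover have "0 \<le> x ^ Suc c * ((2 * real c + 3) / (1 - x) + 2 * x / (1 - x)\<^sup>2)"
    using assms by (intro mult_nonneg_nonneg add_nonneg_nonneg divide_nonneg_nonneg) auto
  ultimately show ?thesis by (metis le_add_same_cancel1)
qed

section \<open>Smooth numbers, assembled one integer at a time\<close>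

definition prime_component :: "nat \<Rightarrow> nat \<Rightarrow> nat" where
  "prime_component c n = (if prime n then n ^ c else 1)"

text \<open>For positive \<open>d \<le> c\<close>, divisibility of this number by \<open>d\<close>
  says that all prime factors of \<open>d\<close> are at most \<open>n\<close>. It also serves as
  the period of everything revealed up to \<open>n\<close>.\<close>

definition smooth_part :: "nat \<Rightarrow> nat \<Rightarrow> nat" where
  "smooth_part c n = (\<Prod>p | prime p \<and> p \<le> n. p ^ c)"

lemma smooth_part_0: "smooth_part c 0 = 1"
proof -
  have "{p::nat. prime p \<and> p \<le> 0} = {}" by auto
  then show ?thesis by (simp only: smooth_part_def prod.empty)
qed

lemma smooth_part_Suc: "smooth_part c (Suc n) = smooth_part c n * prime_component c (Suc n)"
proof (cases "prime (Suc n)")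
  case True
  then have "{p. prime p \<and> p \<le> Suc n} = insert (Suc n) {p. prime p \<and> p \<le> n}"
    by (auto simp: le_Suc_eq)
  then show ?thesis using True by (simp add: smooth_part_def prime_component_def mult.commute)
next
  case False
  then have "{p. prime p \<and> p \<le> Suc n} = {p. prime p \<and> p \<le> n}" by (auto simp: le_Suc_eq)
  then show ?thesis using False by (simp add: smooth_part_def prime_component_def)
qed

lemma smooth_part_pos: "smooth_part c n > 0"
  by (auto simp: smooth_part_def prime_gt_0_nat intro!: prod_pos)

lemma prime_component_pos: "prime_component c n > 0"
  by (auto simp: prime_component_def prime_gt_0_nat)

lemma coprime_smooth_part_prime_component: "coprime (smooth_part c n) (prime_component c (Suc n))"
proof (cases "prime (Suc n)")
  case True
  have "coprime p (Suc n)" if "prime p" "p \<le> n" for p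
    using that True by (intro primes_coprime) auto
  then have "coprime (p ^ c) (Suc n ^ c)" if "prime p" "p \<le> n" for p
    using that by (simp add: coprime_power_left_iff coprime_power_right_iff)
  with True show ?thesis
    by (auto simp: smooth_part_def prime_component_def intro!: prod_coprime_left)
qed (simp add: prime_component_def)

lemma smooth_part_dvd: "n \<le> n' \<Longrightarrow> smooth_part c n dvd smooth_part c n'"
  by (induction rule: dec_induct) (auto simp: smooth_part_Suc)

text \<open>No multiplicity in \<open>d\<close> exceeds \<open>c\<close>, since
  \<open>multiplicity p d < p ^ multiplicity p d \<le> d\<close>.\<close>

lemma dvd_smooth_part:
  assumes "0 < d" "d \<le> c" "d \<le> n"
  shows "d dvd smooth_part c n"
proof -
  have "multiplicity p d \<le> c" if "p \<in> prime_factors d" for p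
  proof -
    have "multiplicity p d < p ^ multiplicity p d"
      using that prime_gt_1_nat by (intro power_gt_expt) auto
    also have "\<dots> \<le> d" using assms by (intro dvd_imp_le multiplicity_dvd)
    finally show ?thesis using assms by simp
  qed
  moreover have "prime_factors d \<subseteq> {p. prime p \<and> p \<le> n}"
    using assms by (auto dest!: dvd_imp_le simp: in_prime_factors_iff)
  ultimately have "(\<Prod>p\<in>prime_factors d. p ^ multiplicity p d) dvd smooth_part c n"
    unfolding smooth_part_def by (intro prod_dvd_prod_subset2) (auto intro: le_imp_power_dvd)
  then show ?thesis using assms by (simp add: prime_factorization_nat[symmetric])
qed

text \<open>The mass of a residue class modulo \<open>m\<close> is at most \<open>nu y \<theta> m\<close> under the distorted measures below: each
  prime factor of \<open>m\<close> beyond \<open>y\<close> costs one factor \<open>\<theta>\<close>.\<close>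

definition nu :: "nat \<Rightarrow> real \<Rightarrow> nat \<Rightarrow> real" where
  "nu y \<theta> m = \<theta> ^ card {q \<in> prime_factors m. y < q} / real m"

lemma nu_1: "nu y \<theta> (Suc 0) = 1"
  by (simp add: nu_def)

lemma nu_nonneg: "0 \<le> \<theta> \<Longrightarrow> 0 \<le> nu y \<theta> m"
  by (simp add: nu_def)

lemma nu_mult:
  assumes "coprime m e" "m > 0" "e > 0"
  shows "nu y \<theta> (m * e) = nu y \<theta> m * nu y \<theta> e"
proof -
  have "{q \<in> prime_factors (m * e). y < q} = {q \<in> prime_factors m. y < q} \<union> {q \<in> prime_factors e. y < q}"
    using assms by (auto simp: prime_factors_product)
  moreover have "prime_factors m \<inter> prime_factors e = {}"
    using assms by (auto simp: in_prime_factors_iff) (meson coprime_common_divisor not_prime_unit)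
  ultimately have "card {q \<in> prime_factors (m * e). y < q} = card {q \<in> prime_factors m. y < q} + card {q \<in> prime_factors e. y < q}"
    by (simp only:) (rule card_Un_disjoint, auto)
  then show ?thesis by (simp add: nu_def power_add)
qed

lemma nu_prime_power:
  assumes "prime p"
  shows "nu y \<theta> (p ^ j) = (if 0 < j \<and> y < p then \<theta> else 1) * (1 / real p) ^ j"
proof (cases "j = 0")
  case False
  then have "{q \<in> prime_factors (p ^ j). y < q} = (if y < p then {p} else {})"
    using assms by (auto simp: prime_factorization_prime_power)
  then show ?thesis using False by (simp add: nu_def power_one_over)
qed (simp add: nu_1)

lemma nu_smooth:
  assumes "m dvd smooth_part c n" "n \<le> y"
  shows "nu y \<theta> m = 1 / real m"
proof -
  have "q \<le> n" if "q \<in> prime_factors m" for q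
  proof -
    have "q dvd smooth_part c n" "prime q" using that assms by (auto intro: dvd_trans)
    then obtain p where "prime p" "p \<le> n" "q dvd p ^ c"
      by (auto simp: smooth_part_def prime_dvd_prod_iff)
    then have "q dvd p" using \<open>prime q\<close> prime_dvd_power by blast
    then show ?thesis using \<open>p \<le> n\<close> \<open>prime p\<close> \<open>prime q\<close> primes_dvd_imp_eq by blast
  qed
  then have "{q \<in> prime_factors m. y < q} = {}" using assms(2) by fastforce
  then show ?thesis by (simp only: nu_def) simp
qed

text \<open>The local factor of \<open>\<Sum> nu (lcm m m')\<close> at a prime \<open>p \<le> y\<close> is \<open>\<Sum>k. (2 * k + 1) / p ^ k = 1 + (3 * p - 1) / (p - 1)\<^sup>2\<close>.\<close>

definition local_factor :: "nat \<Rightarrow> real \<Rightarrow> nat \<Rightarrow> real" where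
  "local_factor y \<theta> p = 1 + (if y < p then \<theta> else 1) * (3 * real p - 1) / (real p - 1)\<^sup>2"

definition euler_product :: "nat \<Rightarrow> real \<Rightarrow> nat \<Rightarrow> real" where
  "euler_product y \<theta> n = (\<Prod>p | prime p \<and> p \<le> n. local_factor y \<theta> p)"

lemma sum_nu_prime_power_le:
  assumes "prime p" "1 \<le> \<theta>"
  shows "(\<Sum>e | e dvd p ^ c. \<Sum>e' | e' dvd p ^ c. nu y \<theta> (lcm e e')) \<le> local_factor y \<theta> p"
proof -
  define x where "x = 1 / real p"
  have p: "real p \<ge> 2" using prime_ge_2_nat[OF assms(1)] by simp
  have x: "0 \<le> x" "x < 1" using p by (auto simp: x_def)
  define t where "t = (if y < p then \<theta> else 1)"
  have t: "t \<ge> 1" using assms by (simp add: t_def)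
  have lcm: "lcm (p ^ i) (p ^ j) = p ^ max i j" for i j
    by (metis lcm_proj1_if_dvd lcm_proj2_if_dvd le_imp_power_dvd max_def nat_le_linear normalize_nat_def id_apply)
  have "(\<Sum>e | e dvd p ^ c. \<Sum>e' | e' dvd p ^ c. nu y \<theta> (lcm e e'))
      = (\<Sum>i\<le>c. \<Sum>j\<le>c. nu y \<theta> (p ^ max i j))"
    by (simp only: sum_divisors_prime_power[OF assms(1)] lcm)
  \<comment> \<open>Only the pair \<open>(0, 0)\<close> has lcm 1 and hence carries no factor
    \<open>t\<close>; the term \<open>1 - t\<close> corrects for it.\<close>
  also have "\<dots> = (\<Sum>i\<le>c. \<Sum>j\<le>c. t * x ^ max i j + (if i = 0 then if j = 0 then 1 - t else 0 else 0))"
    using assms by (intro sum.cong refl) (auto simp: nu_prime_power x_def t_def nu_1)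
  also have "\<dots> = t * (\<Sum>i\<le>c. \<Sum>j\<le>c. x ^ max i j) + (1 - t)"
  proof -
    have "(\<Sum>j\<le>c. if i = 0 then if j = 0 then 1 - t else 0 else 0) = (if i = 0 then 1 - t else 0)" for i :: nat
      by simp
    then show ?thesis by (simp add: sum.distrib sum_distrib_left)
  qed
  also have "\<dots> \<le> t * ((1 + x) / (1 - x)\<^sup>2) + (1 - t)"
    using t by (intro add_right_mono mult_left_mono sum_power_max_le x) auto
  also have "(1 + x) / (1 - x)\<^sup>2 = 1 + (3 * real p - 1) / (real p - 1)\<^sup>2"
  proof -
    define u where "u = real p - 1"
    then have u: "real p = u + 1" "u > 0" using p by auto
    have "(1 + x) / (1 - x)\<^sup>2 = ((1 + x) * real p * real p) / ((1 - x) * real p)\<^sup>2"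
      using p by (simp add: power2_eq_square)
    also have "(1 + x) * real p = u + 2" using p by (simp add: x_def u_def algebra_simps)
    also have "(1 - x) * real p = u" using p by (simp add: x_def u_def algebra_simps)
    also have "(u + 2) * real p / u\<^sup>2 = 1 + (3 * real p - 1) / (real p - 1)\<^sup>2"
      using u by (simp add: field_simps power2_eq_square)
    finally show ?thesis .
  qed
  finally show ?thesis by (simp add: local_factor_def t_def[symmetric] algebra_simps)
qed

lemma euler_product_0: "euler_product y \<theta> 0 = 1"
proof -
  have "{p::nat. prime p \<and> p \<le> 0} = {}" by auto
  then show ?thesis by (simp only: euler_product_def prod.empty)
qed

lemma euler_product_Suc:
  "euler_product y \<theta> (Suc n) = euler_product y \<theta> n * (if prime (Suc n) then local_factor y \<theta> (Suc n) else 1)"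
proof (cases "prime (Suc n)")
  case True
  then have "{p. prime p \<and> p \<le> Suc n} = insert (Suc n) {p. prime p \<and> p \<le> n}"
    by (auto simp: le_Suc_eq)
  then show ?thesis using True by (simp add: euler_product_def mult.commute)
next
  case False
  then have "{p. prime p \<and> p \<le> Suc n} = {p. prime p \<and> p \<le> n}" by (auto simp: le_Suc_eq)
  then show ?thesis using False by (simp add: euler_product_def)
qed

lemma local_factor_ge_1: "p > 0 \<Longrightarrow> 0 \<le> \<theta> \<Longrightarrow> 1 \<le> local_factor y \<theta> p"
  by (simp add: local_factor_def)

lemma euler_product_nonneg: "0 \<le> \<theta> \<Longrightarrow> 0 \<le> euler_product y \<theta> n"
  unfolding euler_product_def
  by (auto intro!: prod_nonneg order.trans[OF zero_le_one local_factor_ge_1] simp: prime_gt_0_nat)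

text \<open>By coprimality both lcm and \<open>nu\<close> split over the earlier smooth part and the
  new prime power, so the double sum gains one local factor per prime.\<close>

lemma sum_nu_lcm_le:
  assumes "1 \<le> \<theta>"
  shows "(\<Sum>m | m dvd smooth_part c n. \<Sum>m' | m' dvd smooth_part c n. nu y \<theta> (lcm m m'))
     \<le> euler_product y \<theta> n"
proof (induction n)
  case 0
  have "{m. m dvd smooth_part c 0} = {1}" by (auto simp: smooth_part_0)
  then show ?case by (simp add: euler_product_0 nu_1)
next
  case (Suc n)
  let ?K = "smooth_part c n" and ?P = "prime_component c (Suc n)"
  have cop: "coprime ?K ?P" by (rule coprime_smooth_part_prime_component)
  have split: "nu y \<theta> (lcm (m * e) (m' * e')) = nu y \<theta> (lcm m m') * nu y \<theta> (lcm e e')"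
    if "m dvd ?K" "m' dvd ?K" "e dvd ?P" "e' dvd ?P" for m m' e e'
  proof -
    have "coprime (lcm m m') (lcm e e')"
      using that cop coprime_divisors[of "lcm m m'" ?K "lcm e e'" ?P] by simp
    moreover have "lcm m m' > 0" "lcm e e' > 0"
      using that smooth_part_pos[of c n] prime_component_pos[of c "Suc n"]
      by (auto intro!: Nat.gr0I)
    ultimately show ?thesis by (simp add: lcm_mult_coprime[OF cop that] nu_mult)
  qed
  have "(\<Sum>m | m dvd smooth_part c (Suc n). \<Sum>m' | m' dvd smooth_part c (Suc n). nu y \<theta> (lcm m m'))
      = (\<Sum>m | m dvd ?K. \<Sum>e | e dvd ?P. \<Sum>m' | m' dvd ?K. \<Sum>e' | e' dvd ?P. nu y \<theta> (lcm m m') * nu y \<theta> (lcm e e'))"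
    unfolding smooth_part_Suc sum_divisors_mult[OF cop] by (intro sum.cong refl) (simp add: split)
  also have "\<dots> = (\<Sum>m | m dvd ?K. \<Sum>m' | m' dvd ?K. \<Sum>e | e dvd ?P. \<Sum>e' | e' dvd ?P. nu y \<theta> (lcm m m') * nu y \<theta> (lcm e e'))"
    by (rule sum.cong[OF refl], rule sum.swap)
  also have "\<dots> = (\<Sum>m | m dvd ?K. \<Sum>m' | m' dvd ?K. nu y \<theta> (lcm m m'))
       * (\<Sum>e | e dvd ?P. \<Sum>e' | e' dvd ?P. nu y \<theta> (lcm e e'))"
    by (simp only: sum_distrib_right) (simp only: sum_distrib_left)
  also have "\<dots> \<le> euler_product y \<theta> n * (if prime (Suc n) then local_factor y \<theta> (Suc n) else 1)"
  proof (rule mult_mono[OF Suc.IH])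
    show "(\<Sum>e | e dvd ?P. \<Sum>e' | e' dvd ?P. nu y \<theta> (lcm e e'))
        \<le> (if prime (Suc n) then local_factor y \<theta> (Suc n) else 1)"
    proof (cases "prime (Suc n)")
      case True
      then show ?thesis using sum_nu_prime_power_le[OF True assms] by (simp add: prime_component_def)
    qed (simp add: prime_component_def nu_1)
    show "0 \<le> euler_product y \<theta> n"
      using assms by (intro euler_product_nonneg) simp
    show "0 \<le> (\<Sum>e | e dvd ?P. \<Sum>e' | e' dvd ?P. nu y \<theta> (lcm e e'))"
      using assms by (intro sum_nonneg nu_nonneg) auto
  qed
  finally show ?case by (simp only: euler_product_Suc)
qed

text \<open>For Rankin's trick on the smooth moduli: \<open>root 3 d / d\<close> is multiplicative,
  so the divisor sum is a product of truncated geometric series.\<close>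

lemma sum_root_divisors_le:
  shows "(\<Sum>d | d dvd smooth_part c n. root 3 d / d) \<le> (\<Prod>p | prime (p::nat) \<and> p \<le> n. 1 / (1 - root 3 p / p))"
proof (induction n)
  case 0
  have "{m. m dvd smooth_part c 0} = {1}" "{p::nat. prime p \<and> p \<le> 0} = {}" by (auto simp: smooth_part_0)
  then show ?case by (simp only: prod.empty) simp
next
  case (Suc n)
  let ?K = "smooth_part c n" and ?P = "prime_component c (Suc n)"
  have "(\<Sum>d | d dvd smooth_part c (Suc n). root 3 d / d)
      = (\<Sum>d | d dvd ?K. root 3 d / d) * (\<Sum>e | e dvd ?P. root 3 e / e)"
    by (simp add: smooth_part_Suc sum_divisors_mult[OF coprime_smooth_part_prime_component]
       real_root_mult sum_product)
  also have "\<dots> \<le> (\<Prod>p | prime (p::nat) \<and> p \<le> n. 1 / (1 - root 3 p / p)) * (\<Sum>e | e dvd ?P. root 3 e / e)"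
    by (intro mult_right_mono Suc.IH sum_nonneg) auto
  also have "\<dots> \<le> (\<Prod>p | prime (p::nat) \<and> p \<le> Suc n. 1 / (1 - root 3 p / p))"
  proof (cases "prime (Suc n)")
    case False
    then have "{p. prime p \<and> p \<le> Suc n} = {p. prime p \<and> p \<le> n}" by (auto simp: le_Suc_eq)
    with False show ?thesis by (simp add: prime_component_def)
  next
    case True
    let ?x = "\<lambda>p. root 3 (real p) / real p"
    have lt: "?x p < 1" "0 \<le> ?x p" if "prime p" for p
    proof -
      have p: "real p \<ge> 2" using prime_ge_2_nat[OF that] by simp
      then have "root 3 (real p) < root 3 (real p ^ 3)"
        by (intro real_root_less_mono) (auto simp: power_strict_increasing[of 1 3 "real p", simplified])
      then show "?x p < 1" using p by (simp add: real_root_power_cancel)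
    qed auto
    have "(\<Sum>e | e dvd ?P. root 3 e / e) = (\<Sum>j\<le>c. ?x (Suc n) ^ j)"
      using True by (simp add: prime_component_def sum_divisors_prime_power real_root_power power_divide)
    also have "\<dots> \<le> 1 / (1 - ?x (Suc n))" using lt[OF True] by (intro sum_power_le) auto
    finally have "(\<Prod>p | prime p \<and> p \<le> n. 1 / (1 - ?x p)) * (\<Sum>e | e dvd ?P. root 3 e / e)
        \<le> (\<Prod>p | prime p \<and> p \<le> n. 1 / (1 - ?x p)) * (1 / (1 - ?x (Suc n)))"
      using lt by (intro mult_left_mono prod_nonneg) (auto simp: less_imp_le)
    moreover have "{p. prime p \<and> p \<le> Suc n} = insert (Suc n) {p. prime p \<and> p \<le> n}"
      using True by (auto simp: le_Suc_eq)
    ultimately show ?thesis by (simp add: mult.commute)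
  qed
  finally show ?case .
qed

section \<open>The distorted measures\<close>

text \<open>To be applied with \<open>g\<close> the indicator of the new classes: on one fibre their
  proportion is constant, so the distortion is affine in that indicator.\<close>

lemma fibre_avg_affine:
  assumes "P > 0" "\<And>t. h (x + int (K * t)) = u + v * g (x + int (K * t))"
  shows "fibre_avg K P h x = u + v * fibre_avg K P g x"
  using assms by (simp add: fibre_avg_def sum.distrib sum_distrib_left[symmetric] add_divide_distrib)

text \<open>Two residue classes are disjoint or meet in a class modulo the lcm. As an inequality
  this also covers the disjoint case, where any \<open>z\<close> serves.\<close>

lemma residue_ind_inter_le:
  "\<exists>z. \<forall>x. residue_ind a m x * residue_ind b m' x \<le> residue_ind z (lcm m m') x"
proof (cases "\<exists>z. [z = a] (mod int m) \<and> [z = b] (mod int m')")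
  case True
  then obtain z where z: "[z = a] (mod int m)" "[z = b] (mod int m')" by blast
  have "[x = z] (mod int (lcm m m'))" if "[x = a] (mod int m)" "[x = b] (mod int m')" for x
  proof -
    have "[x = z] (mod int m)" "[x = z] (mod int m')" using z that cong_trans cong_sym by blast+
    then have "int m dvd x - z" "int m' dvd x - z" by (auto simp: cong_iff_dvd_diff)
    then have "lcm (int m) (int m') dvd x - z" by (rule lcm_least)
    then show ?thesis by (simp add: cong_iff_dvd_diff lcm_int_int_eq)
  qed
  then show ?thesis by (intro exI[of _ z]) (auto simp: residue_ind_def)
next
  case False
  then show ?thesis by (intro exI[of _ 0]) (auto simp: residue_ind_def)
qed

text \<open>Residues are a function of the modulus, so distinctness of the moduli is built in.
  \<open>c\<close> is the prime exponent in the periods, and the measure stays uniform up to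
  \<open>y\<close>.\<close>

locale residue_classes =
  fixes D :: "nat set" and r :: "nat \<Rightarrow> int" and c y :: nat and \<delta> :: real
  assumes finite_D: "finite D" and delta: "0 < \<delta>" "\<delta> < 1"
begin

abbreviation K :: "nat \<Rightarrow> nat" where "K \<equiv> smooth_part c"
abbreviation P :: "nat \<Rightarrow> nat" where "P n \<equiv> prime_component c (Suc n)"
abbreviation \<theta> :: real where "\<theta> \<equiv> 1 / (1 - \<delta>)"

lemma theta_ge_1: "1 \<le> \<theta>"
  using delta by (simp add: field_simps)

text \<open>Stage \<open>n\<close> treats the integer \<open>Suc n\<close>: the moduli selected are
  those dividing \<open>K (Suc n)\<close> with largest prime factor \<open>Suc n\<close>, hence none
  if \<open>Suc n\<close> is not prime.\<close>

definition new_ind :: "nat \<Rightarrow> int \<Rightarrow> real" where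
  "new_ind n x = of_bool (\<exists>d\<in>D. d dvd K (Suc n) \<and> \<not> d dvd K n \<and> [x = r d] (mod int d))"

definition new_prop :: "nat \<Rightarrow> int \<Rightarrow> real" where
  "new_prop n = fibre_avg (K n) (P n) (new_ind n)"

text \<open>Reweights each fibre so that its total mass is preserved: the new residue classes lose all their mass where they
  fill less than a proportion \<open>\<delta>\<close> of the fibre, and as much as the density bound \<open>1 / (1 - \<delta>)\<close> permits elsewhere.\<close>

definition distortion :: "nat \<Rightarrow> int \<Rightarrow> real" where
  "distortion n x =
     (if n < y then 1
      else if new_prop n x < \<delta> then (1 - new_ind n x) / (1 - new_prop n x)
      else (new_prop n x - \<delta> * new_ind n x) / (new_prop n x * (1 - \<delta>)))"

primrec density :: "nat \<Rightarrow> int \<Rightarrow> real" where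
  "density 0 = (\<lambda>x. 1)"
| "density (Suc n) = (\<lambda>x. density n x * distortion n x)"

section \<open>Periods, size and mass of the distortion\<close>

lemma new_ind_bounds: "0 \<le> new_ind n x" "new_ind n x \<le> 1"
  by (auto simp: new_ind_def)

lemma new_prop_bounds: "0 \<le> new_prop n x" "new_prop n x \<le> 1"
  using fibre_avg_mono[of "\<lambda>x. 0" "new_ind n" "K n" "P n" x] fibre_avg_mono[of "new_ind n" "\<lambda>x. 1" "K n" "P n" x]
  by (auto simp: new_prop_def fibre_avg_const prime_component_pos new_ind_bounds)

lemma periodic_new_ind: "periodic (K (Suc n)) (new_ind n)"
proof -
  have "[x + int (K (Suc n)) = r d] (mod int d) \<longleftrightarrow> [x = r d] (mod int d)" if "d dvd K (Suc n)" for x d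
    using periodic_residue_ind[OF that, of "r d"] by (simp add: periodic_def residue_ind_def of_bool_eq_iff)
  then show ?thesis by (simp add: periodic_def new_ind_def cong: conj_cong)
qed

lemma periodic_new_prop: "periodic (K n) (new_prop n)"
  unfolding new_prop_def by (rule periodic_fibre_avg) (metis periodic_new_ind smooth_part_Suc)

lemma periodic_distortion: "periodic (K (Suc n)) (distortion n)"
  using periodic_new_ind[of n] periodic_dvd[OF periodic_new_prop[of n], of "K (Suc n)"]
  by (simp add: periodic_def distortion_def smooth_part_Suc)

lemma periodic_density: "periodic (K n) (density n)"
proof (induction n)
  case (Suc n)
  then have "periodic (K (Suc n)) (density n)" by (rule periodic_dvd) (simp add: smooth_part_Suc)
  then show ?case using periodic_distortion by (simp add: periodic_mult)
qed (simp add: periodic_def)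

lemma distortion_bounds: "0 \<le> distortion n x" "distortion n x \<le> (if n < y then 1 else \<theta>)"
proof -
  let ?a = "new_prop n x" and ?b = "new_ind n x"
  have b: "?b = 0 \<or> ?b = 1" by (auto simp: new_ind_def)
  have "0 \<le> distortion n x \<and> distortion n x \<le> (if n < y then 1 else \<theta>)"
  proof (cases "n < y")
    case False
    show ?thesis
    proof (cases "?a < \<delta>")
      case True
      then show ?thesis using False b delta by (auto simp: distortion_def frac_le)
    next
      case a: False
      then have "?a > 0" using delta by simp
      have "(?a - \<delta>) / (?a * (1 - \<delta>)) \<le> ?a / (?a * (1 - \<delta>))"
        using \<open>?a > 0\<close> delta by (intro divide_right_mono) auto
      also have "\<dots> = \<theta>" using \<open>?a > 0\<close> by simp
      finally show ?thesis using False a b delta \<open>?a > 0\<close> by (auto simp: distortion_def)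
    qed
  qed (simp add: distortion_def)
  then show "0 \<le> distortion n x" "distortion n x \<le> (if n < y then 1 else \<theta>)" by auto
qed

lemma density_nonneg: "0 \<le> density n x"
  by (induction n) (auto simp: distortion_bounds)

lemma new_prop_fibre: "new_prop n (x + int (K n) * int t) = new_prop n x"
  by (rule periodic_shift[OF periodic_new_prop])

text \<open>On a fibre the distortion has the form \<open>u + v * new_ind\<close>, and both branches
  are normalised so that \<open>u + v * new_prop = 1\<close>.\<close>

lemma fibre_avg_distortion: "fibre_avg (K n) (P n) (distortion n) x = 1"
proof -
  let ?a = "new_prop n x"
  define u where "u = (if n < y then 1 else if ?a < \<delta> then 1 / (1 - ?a) else ?a / (?a * (1 - \<delta>)))"
  define v where "v = (if n < y then 0 else if ?a < \<delta> then - 1 / (1 - ?a) else - \<delta> / (?a * (1 - \<delta>)))"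
  have "fibre_avg (K n) (P n) (distortion n) x = u + v * ?a"
    unfolding new_prop_def[of n]
    by (rule fibre_avg_affine[OF prime_component_pos])
       (simp add: distortion_def new_prop_fibre u_def v_def diff_divide_distrib)
  also have "\<dots> = 1"
  proof (cases "?a < \<delta>")
    case True
    then show ?thesis using delta by (simp add: u_def v_def field_simps)
  next
    case False
    then have "?a \<noteq> 0" using delta by auto
    then have "?a / (?a * (1 - \<delta>)) + - \<delta> / (?a * (1 - \<delta>)) * ?a = 1"
      using delta by (simp add: diff_divide_distrib[symmetric])
    then show ?thesis using False delta by (simp add: u_def v_def)
  qed
  finally show ?thesis .
qed

text \<open>With \<alpha> = \<open>new_prop n x\<close>, the new classes keep the share
  \<open>max 0 (\<alpha> - \<delta>) / (1 - \<delta>)\<close>, and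
  \<open>(\<alpha> - 2 * \<delta>)\<^sup>2 \<ge> 0\<close> makes the bound quadratic.\<close>

lemma fibre_avg_distortion_new_ind_le:
  assumes "y \<le> n"
  shows "fibre_avg (K n) (P n) (\<lambda>x. distortion n x * new_ind n x) x \<le> (new_prop n x)\<^sup>2 / (4 * \<delta> * (1 - \<delta>))"
proof -
  let ?a = "new_prop n x"
  define v where "v = (if ?a < \<delta> then 0 else (?a - \<delta>) / (?a * (1 - \<delta>)))"
  \<comment> \<open>As \<open>new_ind\<close> is 0 or 1, the product equals
    \<open>v * new_ind\<close> on the fibre.\<close>
  have "fibre_avg (K n) (P n) (\<lambda>x. distortion n x * new_ind n x) x = 0 + v * ?a"
    unfolding new_prop_def[of n]
    by (rule fibre_avg_affine[OF prime_component_pos])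
       (use assms in \<open>simp add: distortion_def new_prop_fibre v_def\<close>, auto simp: new_ind_def)
  also have "\<dots> \<le> ?a\<^sup>2 / (4 * \<delta> * (1 - \<delta>))"
  proof (cases "?a < \<delta>")
    case False
    have "4 * \<delta> * (?a - \<delta>) \<le> ?a\<^sup>2" 
      using zero_le_power2[of "?a - 2 * \<delta>"] by (simp add: power2_eq_square algebra_simps)
    then have "4 * \<delta> * (?a - \<delta>) / (4 * \<delta> * (1 - \<delta>)) \<le> ?a\<^sup>2 / (4 * \<delta> * (1 - \<delta>))"
      using delta by (intro divide_right_mono) auto
    then have "(?a - \<delta>) / (1 - \<delta>) \<le> ?a\<^sup>2 / (4 * \<delta> * (1 - \<delta>))"
      using delta by simp
    moreover have "v * ?a = (?a - \<delta>) / (1 - \<delta>)" using False delta by (simp add: v_def)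
    ultimately show ?thesis by simp
  qed (use delta in \<open>simp add: v_def\<close>)
  finally show ?thesis .
qed

text \<open>\<open>u\<close> is constant on the fibres of stage \<open>n\<close>, where the
  distortion averages to 1. So a stage never changes the mass of events decided earlier.\<close>

lemma avg_density_Suc:
  assumes "periodic (K n) u" "Suc n \<le> L"
  shows "avg (K L) (\<lambda>x. density (Suc n) x * u x) = avg (K L) (\<lambda>x. density n x * u x)"
proof -
  let ?h = "\<lambda>x. (density n x * u x) * distortion n x"
  have "periodic (K (Suc n)) ?h"
    by (intro periodic_mult periodic_distortion periodic_dvd[OF periodic_density] periodic_dvd[OF assms(1)])
       (auto simp: smooth_part_Suc)
  then have "periodic (K L) ?h" using assms(2) by (rule periodic_dvd[OF _ smooth_part_dvd])
  then have "avg (K L) ?h = avg (K L) (fibre_avg (K n) (P n) ?h)"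
    by (simp add: avg_fibre_avg smooth_part_pos prime_component_pos)
  also have "fibre_avg (K n) (P n) ?h = (\<lambda>x. density n x * u x)"
    using fibre_avg_mult[OF periodic_mult[OF periodic_density assms(1)]] fibre_avg_distortion by (auto simp: fun_eq_iff)
  finally show ?thesis by (simp add: mult_ac)
qed

lemma avg_density_mono:
  assumes "n \<le> n'" "n' \<le> L" "periodic (K n) u"
  shows "avg (K L) (\<lambda>x. density n' x * u x) = avg (K L) (\<lambda>x. density n x * u x)"
  using assms(1,2)
proof (induction n' rule: dec_induct)
  case (step j)
  then have "periodic (K j) u" using assms(3) by (meson periodic_dvd smooth_part_dvd)
  then show ?case using step avg_density_Suc[of j u L] by simp
qed simp

text \<open>Induction over the stages, splitting \<open>m\<close> into a part \<open>m'\<close> from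
  earlier primes and a power \<open>e\<close> of \<open>Suc n\<close>. If \<open>e = 1\<close> the
  mass is unchanged; otherwise the stage costs the density bound and gains
  \<open>1 / e\<close>.\<close>

lemma avg_density_residue_ind_le:
  assumes "n \<le> L" "m dvd K n"
  shows "avg (K L) (\<lambda>x. density n x * residue_ind a m x) \<le> nu y \<theta> m"
  using assms
proof (induction n arbitrary: m)
  case 0
  then have "m = 1" by (simp add: smooth_part_0)
  then show ?case by (simp add: avg_residue_ind[of 1, simplified] smooth_part_pos nu_1)
next
  case (Suc n)
  have cop: "coprime (K n) (P n)" by (rule coprime_smooth_part_prime_component)
  define m' where "m' = gcd m (K n)"
  define e where "e = gcd m (P n)"
  have m: "m = m' * e" "m' dvd K n" "e dvd P n"
    using gcd_mult_gcd_coprime[OF cop, of m] Suc.prems by (auto simp: m'_def e_def smooth_part_Suc)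
  have cop': "coprime m' e" using m cop coprime_divisors by blast
  have pos: "m' > 0" "e > 0" using m smooth_part_pos[of c n] prime_component_pos[of c "Suc n"]
    by (auto intro!: Nat.gr0I)
  show ?case
  proof (cases "e = 1")
    case True
    then have "m dvd K n" using m by simp
    then have "avg (K L) (\<lambda>x. density (Suc n) x * residue_ind a m x) = avg (K L) (\<lambda>x. density n x * residue_ind a m x)"
      using Suc.prems by (intro avg_density_Suc periodic_residue_ind)
    also have "\<dots> \<le> nu y \<theta> m" using Suc.prems \<open>m dvd K n\<close> by (intro Suc.IH) auto
    finally show ?thesis .
  next
    case False
    define T where "T = (if n < y then 1 else \<theta>)"
    have T: "0 \<le> T" using delta by (simp add: T_def)
    have prime: "prime (Suc n)" using False m by (auto simp: prime_component_def split: if_splits)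
    obtain j where j: "e = Suc n ^ j" using m prime divides_primepow_nat[OF prime] by (auto simp: prime_component_def)
    have "j > 0" using False j by (cases j) auto
    then have nu_e: "nu y \<theta> e = T / real e"
      using prime by (auto simp: j nu_prime_power T_def power_one_over)
    let ?h = "\<lambda>x. density n x * residue_ind a m' x"
    have per: "periodic (K n) ?h" by (intro periodic_mult periodic_density periodic_residue_ind m)
    \<comment> \<open>Once the distortion is replaced by its bound \<open>T\<close>, the fibre is
      uniform again, so the condition modulo \<open>e\<close> contributes exactly
      \<open>1 / e\<close>.\<close>
    have "avg (K L) (\<lambda>x. density (Suc n) x * residue_ind a m x)
        \<le> avg (K L) (\<lambda>x. T * (?h x * residue_ind a e x))"
    proof (rule avg_mono)
      fix x
      have "distortion n x * (?h x * residue_ind a e x) \<le> T * (?h x * residue_ind a e x)"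
        using distortion_bounds(2)[of n x] density_nonneg residue_ind_nonneg
        by (intro mult_right_mono mult_nonneg_nonneg) (auto simp: T_def)
      then show "density (Suc n) x * residue_ind a m x \<le> T * (?h x * residue_ind a e x)"
        unfolding m(1) residue_ind_mult[OF cop'] by (simp add: mult_ac)
    qed
    also have "\<dots> = T * avg (K L) (\<lambda>x. ?h x * residue_ind a e x)" by (rule avg_cmult)
    also have "avg (K L) (\<lambda>x. ?h x * residue_ind a e x) = avg (K L) (fibre_avg (K n) (P n) (\<lambda>x. ?h x * residue_ind a e x))"
    proof (rule avg_fibre_avg[symmetric])
      have "K n * P n dvd K L" using Suc.prems smooth_part_dvd[of "Suc n" L c] by (simp add: smooth_part_Suc)
      then have "K n dvd K L" "e dvd K L" using m(3) by (blast dest: dvd_mult_left, blast dest: dvd_mult_right dvd_trans)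
      then show "periodic (K L) (\<lambda>x. ?h x * residue_ind a e x)"
        by (rule periodic_mult[OF periodic_dvd[OF per] periodic_residue_ind])
    qed (auto simp: smooth_part_pos prime_component_pos)
    also have "fibre_avg (K n) (P n) (\<lambda>x. ?h x * residue_ind a e x) = (\<lambda>x. 1 / real e * ?h x)"
      using fibre_avg_residue_ind[OF cop m(3) prime_component_pos]
      by (simp add: fun_eq_iff fibre_avg_mult[OF per])
    also have "avg (K L) (\<lambda>x. 1 / real e * ?h x) = 1 / real e * avg (K L) ?h" by (rule avg_cmult)
    also have "T * (1 / real e * avg (K L) ?h) \<le> T * (1 / real e * nu y \<theta> m')"
      using Suc.prems m T by (intro mult_left_mono Suc.IH) auto
    also have "\<dots> = nu y \<theta> m" by (simp add: m(1) nu_mult[OF cop' pos] nu_e)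
    finally show ?thesis .
  qed
qed

text \<open>Union bound on the fibre. A class modulo \<open>d\<close> is a condition modulo
  \<open>gcd d (K n)\<close>, constant on the fibre, combined with an independent one modulo
  \<open>gcd d (P n)\<close>.\<close>

lemma new_prop_le:
  "new_prop n x \<le> (\<Sum>d\<in>{d\<in>D. d dvd K (Suc n) \<and> \<not> d dvd K n}.
      1 / real (gcd d (P n)) * residue_ind (r d) (gcd d (K n)) x)" (is "_ \<le> sum _ ?D")
proof -
  have cop: "coprime (K n) (P n)" by (rule coprime_smooth_part_prime_component)
  have "new_prop n x \<le> fibre_avg (K n) (P n) (\<lambda>x. \<Sum>d\<in>?D. residue_ind (r d) d x) x"
    unfolding new_prop_def
  proof (rule fibre_avg_mono)
    fix x
    show "new_ind n x \<le> (\<Sum>d\<in>?D. residue_ind (r d) d x)"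
    proof (cases "\<exists>d\<in>?D. [x = r d] (mod int d)")
      case True
      then obtain d where d: "d \<in> ?D" "[x = r d] (mod int d)" by blast
      have "new_ind n x \<le> residue_ind (r d) d x" using d(2) by (simp add: residue_ind_def new_ind_bounds)
      also have "\<dots> \<le> (\<Sum>d\<in>?D. residue_ind (r d) d x)"
        using d(1) finite_D by (intro member_le_sum residue_ind_nonneg) auto
      finally show ?thesis .
    next
      case False
      then have "new_ind n x = 0" by (auto simp: new_ind_def)
      then show ?thesis by (simp add: sum_nonneg residue_ind_nonneg)
    qed
  qed
  also have "\<dots> = (\<Sum>d\<in>?D. fibre_avg (K n) (P n) (residue_ind (r d) d) x)" by (rule fibre_avg_sum)
  also have "\<dots> = (\<Sum>d\<in>?D. 1 / real (gcd d (P n)) * residue_ind (r d) (gcd d (K n)) x)"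
  proof (rule sum.cong[OF refl])
    fix d assume "d \<in> ?D"
    then have d: "gcd d (K n) * gcd d (P n) = d"
      using gcd_mult_gcd_coprime[OF cop, of d] by (simp add: smooth_part_Suc)
    have "coprime (gcd d (K n)) (gcd d (P n))" using cop coprime_divisors gcd_dvd2 by blast
    then have "residue_ind (r d) d = (\<lambda>x. residue_ind (r d) (gcd d (K n)) x * residue_ind (r d) (gcd d (P n)) x)"
      using residue_ind_mult[of "gcd d (K n)" "gcd d (P n)" "r d"] by (simp add: d fun_eq_iff)
    then show "fibre_avg (K n) (P n) (residue_ind (r d) d) x = 1 / real (gcd d (P n)) * residue_ind (r d) (gcd d (K n)) x"
      by (simp only:) (simp add: fibre_avg_mult periodic_residue_ind fibre_avg_residue_ind[OF cop] prime_component_pos)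
  qed
  finally show ?thesis .
qed

text \<open>Squaring the union bound produces pairs of classes, each meeting within a class modulo
  an lcm, whose mass \<open>nu\<close> bounds. Summed over all divisor pairs this factors into the
  Euler product and the square of \<open>\<Sum>j\<ge>1. 1 / p ^ j\<close>, which is
  \<open>1 / (p - 1)\<close> with \<open>p - 1 = n\<close>.\<close>

lemma second_moment_le:
  assumes "Suc n \<le> L" "prime (Suc n)"
  shows "avg (K L) (\<lambda>x. density n x * (new_prop n x)\<^sup>2) \<le> euler_product y \<theta> n / (real n)\<^sup>2"
proof -
  have cop: "coprime (K n) (P n)" by (rule coprime_smooth_part_prime_component)
  let ?D = "{d\<in>D. d dvd K (Suc n) \<and> \<not> d dvd K n}"
  let ?m = "\<lambda>d. gcd d (K n)" and ?e = "\<lambda>d. 1 / real (gcd d (P n))"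
  let ?i = "\<lambda>d. residue_ind (r d) (?m d)"
  define X where "X = {(m, e). m dvd K n \<and> e dvd P n \<and> e \<noteq> 1}"
  have X: "X = {m. m dvd K n} \<times> ({e. e dvd P n} - {1})" by (auto simp: X_def)
  have fin: "finite {m. m dvd K n}" "finite {e. e dvd P n}"
    using smooth_part_pos prime_component_pos by (auto intro: finite_divisors)
  have pair: "avg (K L) (\<lambda>x. density n x * (?i d x * ?i d' x)) \<le> nu y \<theta> (lcm (?m d) (?m d'))" for d d'
  proof -
    obtain z where z: "\<And>x. ?i d x * ?i d' x \<le> residue_ind z (lcm (?m d) (?m d')) x"
      using residue_ind_inter_le by blast
    have "avg (K L) (\<lambda>x. density n x * (?i d x * ?i d' x))
        \<le> avg (K L) (\<lambda>x. density n x * residue_ind z (lcm (?m d) (?m d')) x)"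
      by (intro avg_mono mult_left_mono z density_nonneg)
    also have "\<dots> \<le> nu y \<theta> (lcm (?m d) (?m d'))"
      using assms by (intro avg_density_residue_ind_le) auto
    finally show ?thesis .
  qed
  have expand: "density n x * (new_prop n x)\<^sup>2
     \<le> (\<Sum>d\<in>?D. \<Sum>d'\<in>?D. (?e d * ?e d') * (density n x * (?i d x * ?i d' x)))" for x
  proof -
    have "(new_prop n x)\<^sup>2 \<le> (\<Sum>d\<in>?D. ?e d * ?i d x)\<^sup>2"
      by (intro power_mono new_prop_le new_prop_bounds)
    also have "\<dots> = (\<Sum>d\<in>?D. \<Sum>d'\<in>?D. (?e d * ?i d x) * (?e d' * ?i d' x))"
      by (simp only: power2_eq_square sum_product)
    finally have "density n x * (new_prop n x)\<^sup>2 \<le> density n x * \<dots>"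
      by (rule mult_left_mono[OF _ density_nonneg])
    also have "\<dots> = (\<Sum>d\<in>?D. \<Sum>d'\<in>?D. (?e d * ?e d') * (density n x * (?i d x * ?i d' x)))"
      unfolding sum_distrib_left by (intro sum.cong refl) (simp only: mult_ac)
    finally show ?thesis .
  qed
  let ?F = "\<lambda>(m, e) (m', e'). 1 / real e * (1 / real e') * nu y \<theta> (lcm m m')"
  let ?g = "\<lambda>d. (?m d, gcd d (P n))"
  \<comment> \<open>Distinctness of the moduli enters here: a modulus is the product of its two
    gcds, so every pair of divisors is counted at most once.\<close>
  have inj: "inj_on ?g ?D"
    by (rule inj_onI) (metis (no_types, lifting) gcd_mult_gcd_coprime[OF cop] mem_Collect_eq prod.inject smooth_part_Suc)
  have sub: "?g ` ?D \<subseteq> X"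
  proof
    fix q assume "q \<in> ?g ` ?D"
    then obtain d where d: "d \<in> D" "d dvd K n * P n" "\<not> d dvd K n" "q = ?g d" by (auto simp: smooth_part_Suc)
    \<comment> \<open>A new modulus involves the prime \<open>Suc n\<close>. Excluding
      \<open>e = 1\<close> lowers the geometric sum from \<open>1 + 1 / n\<close> to
      \<open>1 / n\<close>.\<close>
    have "gcd d (P n) \<noteq> 1"
      using gcd_mult_gcd_coprime[OF cop d(2)] d(3) by (metis gcd_dvd2 mult.right_neutral)
    then show "q \<in> X" using d by (simp add: X_def)
  qed
  have nonneg: "0 \<le> ?F q q'" for q q'
    using delta by (auto simp: case_prod_unfold intro!: divide_nonneg_nonneg nu_nonneg)
  have finX: "finite X" using fin by (simp add: X)
  have "avg (K L) (\<lambda>x. density n x * (new_prop n x)\<^sup>2)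
     \<le> avg (K L) (\<lambda>x. \<Sum>d\<in>?D. \<Sum>d'\<in>?D. (?e d * ?e d') * (density n x * (?i d x * ?i d' x)))"
    by (intro avg_mono expand)
  also have "\<dots> = (\<Sum>d\<in>?D. \<Sum>d'\<in>?D. (?e d * ?e d') * avg (K L) (\<lambda>x. density n x * (?i d x * ?i d' x)))"
    by (simp only: avg_sum avg_cmult)
  also have "\<dots> \<le> (\<Sum>d\<in>?D. \<Sum>d'\<in>?D. (?e d * ?e d') * nu y \<theta> (lcm (?m d) (?m d')))"
    by (intro sum_mono mult_left_mono pair) auto
  also have "\<dots> = (\<Sum>d\<in>?D. \<Sum>d'\<in>?D. ?F (?g d) (?g d'))" by simp
  also have "\<dots> = (\<Sum>q\<in>?g ` ?D. \<Sum>q'\<in>?g ` ?D. ?F q q')"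
    by (simp only: sum.reindex[OF inj] o_def)
  also have "\<dots> \<le> (\<Sum>q\<in>?g ` ?D. \<Sum>q'\<in>X. ?F q q')"
    by (intro sum_mono sum_mono2 finX sub nonneg)
  also have "\<dots> \<le> (\<Sum>q\<in>X. \<Sum>q'\<in>X. ?F q q')"
    by (intro sum_mono2 finX sub sum_nonneg nonneg)
  also have "\<dots> = (\<Sum>m | m dvd K n. \<Sum>e\<in>{e. e dvd P n} - {1}. \<Sum>m' | m' dvd K n. \<Sum>e'\<in>{e. e dvd P n} - {1}.
      1 / real e * (1 / real e') * nu y \<theta> (lcm m m'))"
    by (simp add: X sum.cartesian_product')
  also have "\<dots> = (\<Sum>m | m dvd K n. \<Sum>m' | m' dvd K n. \<Sum>e\<in>{e. e dvd P n} - {1}. \<Sum>e'\<in>{e. e dvd P n} - {1}.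
      1 / real e * (1 / real e') * nu y \<theta> (lcm m m'))"
    by (rule sum.cong[OF refl], rule sum.swap)
  also have "\<dots> = (\<Sum>m | m dvd K n. \<Sum>m' | m' dvd K n. nu y \<theta> (lcm m m')) * (\<Sum>e\<in>{e. e dvd P n} - {1}. 1 / real e)\<^sup>2"
  proof -
    have "(\<Sum>e\<in>E. \<Sum>e'\<in>E. 1 / real e * (1 / real e') * t) = t * (\<Sum>e\<in>E. 1 / real e)\<^sup>2" for E t
      by (simp only: power2_eq_square sum_product, simp only: sum_distrib_left, simp only: mult_ac)
    then show ?thesis by (simp only: sum_distrib_right)
  qed
  also have "\<dots> \<le> euler_product y \<theta> n * (1 / real n)\<^sup>2"
  proof (rule mult_mono[OF sum_nu_lcm_le[OF theta_ge_1]])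
    have n: "n > 0" using assms by (cases n) auto
    have "(\<Sum>e | e dvd P n. 1 / real e) = (\<Sum>j\<le>c. (1 / real (Suc n)) ^ j)"
      using assms by (simp add: prime_component_def sum_divisors_prime_power power_one_over del: of_nat_Suc)
    also have "\<dots> \<le> 1 / (1 - 1 / real (Suc n))" using n by (intro sum_power_le) auto
    also have "\<dots> = 1 + 1 / real n" using n by (simp add: field_simps)
    finally have "(\<Sum>e\<in>{e. e dvd P n} - {1}. 1 / real e) \<le> 1 / real n"
      by (subst sum_diff1) (auto simp: fin)
    then show "(\<Sum>e\<in>{e. e dvd P n} - {1}. 1 / real e)\<^sup>2 \<le> (1 / real n)\<^sup>2"
      by (intro power_mono sum_nonneg) auto
    show "0 \<le> euler_product y \<theta> n"
      using delta by (intro euler_product_nonneg) simp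
  qed simp
  finally show ?thesis by (simp add: power_divide)
qed

lemma avg_new_ind_le:
  assumes "y \<le> n" "Suc n \<le> L"
  shows "avg (K L) (\<lambda>x. density (Suc n) x * new_ind n x)
     \<le> (if prime (Suc n) then euler_product y \<theta> n / (real n)\<^sup>2 else 0) / (4 * \<delta> * (1 - \<delta>))"
proof (cases "prime (Suc n)")
  case False
  then have "new_ind n = (\<lambda>x. 0)" by (auto simp: new_ind_def smooth_part_Suc prime_component_def)
  then show ?thesis using False by (simp add: avg_def)
next
  case True
  let ?h = "\<lambda>x. density n x * (distortion n x * new_ind n x)"
  have "periodic (K (Suc n)) ?h"
    by (intro periodic_mult periodic_distortion periodic_new_ind periodic_dvd[OF periodic_density])
       (simp add: smooth_part_Suc)
  then have "periodic (K L) ?h" using assms(2) by (rule periodic_dvd[OF _ smooth_part_dvd])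
  then have "avg (K L) ?h = avg (K L) (fibre_avg (K n) (P n) ?h)"
    by (simp add: avg_fibre_avg smooth_part_pos prime_component_pos)
  also have "\<dots> = avg (K L) (\<lambda>x. density n x * fibre_avg (K n) (P n) (\<lambda>x. distortion n x * new_ind n x) x)"
    by (rule arg_cong[where f = "avg (K L)"]) (simp add: fun_eq_iff fibre_avg_mult[OF periodic_density])
  also have "\<dots> \<le> avg (K L) (\<lambda>x. density n x * ((new_prop n x)\<^sup>2 / (4 * \<delta> * (1 - \<delta>))))"
    by (intro avg_mono mult_left_mono fibre_avg_distortion_new_ind_le assms density_nonneg)
  also have "\<dots> = avg (K L) (\<lambda>x. 1 / (4 * \<delta> * (1 - \<delta>)) * (density n x * (new_prop n x)\<^sup>2))"
    by (simp add: mult_ac)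
  also have "\<dots> = 1 / (4 * \<delta> * (1 - \<delta>)) * avg (K L) (\<lambda>x. density n x * (new_prop n x)\<^sup>2)"
    by (rule avg_cmult)
  also have "\<dots> \<le> 1 / (4 * \<delta> * (1 - \<delta>)) * (euler_product y \<theta> n / (real n)\<^sup>2)"
    using delta by (intro mult_left_mono second_moment_le assms True) auto
  finally show ?thesis using True by (simp add: mult_ac)
qed

text \<open>Union bound under the last measure, which has total mass 1. A smooth modulus costs at
  most \<open>1 / d\<close>; any other class is charged to the stage at which its modulus first
  divides \<open>K\<close>, and later stages preserve that mass.\<close>

theorem covering_bound:
  assumes cover: "\<And>x. \<exists>d\<in>D. [x = r d] (mod int d)"
    and dvd: "\<And>d. d \<in> D \<Longrightarrow> d dvd K L" and "y \<le> L"
  shows "1 \<le> (\<Sum>d\<in>{d\<in>D. d dvd K y}. 1 / real d)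
     + (\<Sum>n\<in>{y..<L}. if prime (Suc n) then euler_product y \<theta> n / (real n)\<^sup>2 else 0) / (4 * \<delta> * (1 - \<delta>))"
proof -
  let ?S = "{d\<in>D. d dvd K y}"
  have le: "1 \<le> (\<Sum>d\<in>?S. residue_ind (r d) d x) + (\<Sum>n\<in>{y..<L}. new_ind n x)" for x
  proof -
    obtain d where d: "d \<in> D" "[x = r d] (mod int d)" using cover by blast
    show ?thesis
    proof (cases "d dvd K y")
      case True
      have "1 \<le> residue_ind (r d) d x" using d by (simp add: residue_ind_def)
      also have "\<dots> \<le> (\<Sum>d\<in>?S. residue_ind (r d) d x)"
        using d True finite_D by (intro member_le_sum residue_ind_nonneg) auto
      finally show ?thesis by (simp add: add_increasing2 sum_nonneg new_ind_bounds)
    next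
      case False
      \<comment> \<open>\<open>d\<close> divides \<open>K L\<close> but not \<open>K y\<close>, so
        divisibility must set in at some stage in between.\<close>
      have "\<exists>n\<in>{y..<L}. d dvd K (Suc n) \<and> \<not> d dvd K n"
      proof (rule ccontr)
        assume *: "\<not> ?thesis"
        have "\<not> d dvd K n" if "y \<le> n" "n \<le> L" for n
          using that by (induction n rule: dec_induct) (use False * in auto)
        then show False using dvd d \<open>y \<le> L\<close> by auto
      qed
      then obtain n where n: "n \<in> {y..<L}" "d dvd K (Suc n)" "\<not> d dvd K n" by blast
      have "1 \<le> new_ind n x" using n d by (auto simp: new_ind_def)
      also have "\<dots> \<le> (\<Sum>n\<in>{y..<L}. new_ind n x)"
        using n by (intro member_le_sum new_ind_bounds) auto
      finally show ?thesis by (simp add: add_increasing sum_nonneg residue_ind_nonneg)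
    qed
  qed
  have "avg (K L) (\<lambda>x. density 0 x * 1) = 1" using smooth_part_pos[of c L] by (simp add: avg_def)
  then have "1 = avg (K L) (\<lambda>x. density L x * 1)"
    using avg_density_mono[of 0 L L "\<lambda>x. 1"] by (simp add: periodic_def)
  also have "\<dots> \<le> avg (K L) (\<lambda>x. density L x * ((\<Sum>d\<in>?S. residue_ind (r d) d x) + (\<Sum>n\<in>{y..<L}. new_ind n x)))"
    by (intro avg_mono mult_left_mono le density_nonneg)
  also have "\<dots> = (\<Sum>d\<in>?S. avg (K L) (\<lambda>x. density L x * residue_ind (r d) d x))
     + (\<Sum>n\<in>{y..<L}. avg (K L) (\<lambda>x. density L x * new_ind n x))"
    by (simp only: distrib_left sum_distrib_left avg_add avg_sum)
  also have "\<dots> \<le> (\<Sum>d\<in>?S. 1 / real d) + (\<Sum>n\<in>{y..<L}.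
      (if prime (Suc n) then euler_product y \<theta> n / (real n)\<^sup>2 else 0) / (4 * \<delta> * (1 - \<delta>)))"
  proof (intro add_mono sum_mono)
    fix d assume d: "d \<in> ?S"
    then have "avg (K L) (\<lambda>x. density L x * residue_ind (r d) d x) \<le> nu y \<theta> d"
      using dvd by (intro avg_density_residue_ind_le) auto
    also have "\<dots> = 1 / real d" using d by (intro nu_smooth[of d c y]) auto
    finally show "avg (K L) (\<lambda>x. density L x * residue_ind (r d) d x) \<le> 1 / real d" .
  next
    fix n assume n: "n \<in> {y..<L}"
    then have "avg (K L) (\<lambda>x. density L x * new_ind n x) = avg (K L) (\<lambda>x. density (Suc n) x * new_ind n x)"
      by (intro avg_density_mono periodic_new_ind) auto
    also have "\<dots> \<le> (if prime (Suc n) then euler_product y \<theta> n / (real n)\<^sup>2 else 0) / (4 * \<delta> * (1 - \<delta>))"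
      using n by (intro avg_new_ind_le) auto
    finally show "avg (K L) (\<lambda>x. density L x * new_ind n x) \<le> \<dots>" .
  qed
  finally show ?thesis by (simp only: sum_divide_distrib)
qed

end

section \<open>The tail over large primes\<close>

text \<open>A prime \<open>p \<ge> 210\<close> is coprime to \<open>210 = 2 * 3 * 5 * 7\<close>, and
  numbers in one block have distinct residues modulo 210. So at most \<open>totient 210 = 48\<close>
  occur.\<close>

lemma card_primes_block_le:
  fixes k :: nat
  assumes "k > 0"
  shows "card {p. prime p \<and> 210 * k \<le> p \<and> p < 210 * k + 210} \<le> 48"
proof -
  let ?B = "{p. prime p \<and> 210 * k \<le> p \<and> p < 210 * k + 210}"
  have div: "p div 210 = k" if "p \<in> ?B" for p
    using that by (auto intro!: div_nat_eqI)
  have "inj_on (\<lambda>p. p mod 210) ?B"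
    by (rule inj_onI) (metis div div_mult_mod_eq)
  then have "card ?B = card ((\<lambda>p. p mod 210) ` ?B)" by (simp add: card_image)
  also have "\<dots> \<le> card (totatives 210)"
  proof (rule card_mono)
    show "(\<lambda>p. p mod 210) ` ?B \<subseteq> totatives 210"
    proof
      fix x assume "x \<in> (\<lambda>p. p mod 210) ` ?B"
      then obtain p where p: "x = p mod 210" "prime p" "210 * k \<le> p" by blast
      have "p \<noteq> 210" using prime_product[of 210 1] p(2) by auto
      then have "coprime p 210"
        using p assms by (intro prime_imp_coprime) (auto dest!: dvd_imp_le)
      then have "coprime x 210" using p(1) by simp
      moreover from this have "x > 0" by (cases x) auto
      ultimately show "x \<in> totatives 210" using p(1) by (simp add: totatives_def less_imp_le)
    qed
  qed simp
  also have "\<dots> = totient (2 * (3 * (5 * 7)))" by (simp add: totient_def)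
  also have "\<dots> = 48"
  proof -
    have "coprime (2::nat) (3 * (5 * 7))" "coprime (3::nat) (5 * 7)" "coprime (5::nat) 7"
      unfolding coprime_mult_right_iff by (auto intro!: primes_coprime)
    then have "totient (2 * (3 * (5 * 7))) = totient 2 * (totient 3 * (totient 5 * totient 7))"
      by (simp only: totient_mult_coprime)
    then show ?thesis by (simp add: totient_prime)
  qed
  finally show ?thesis .
qed

text \<open>Bernoulli's inequality gives \<open>1 - n * x \<le> (1 - x) ^ n\<close>, and
  \<open>(1 - x) * (1 + x) \<le> 1\<close>.\<close>

lemma power_one_plus_le:
  fixes x :: real
  assumes "0 \<le> x" "real n * x < 1"
  shows "(1 + x) ^ n \<le> 1 / (1 - real n * x)"
proof (cases "n = 0")
  case False
  then have "x < 1" using assms mult_right_mono[of 1 "real n" x] by auto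
  have "(1 - real n * x) * (1 + x) ^ n \<le> (1 - x) ^ n * (1 + x) ^ n"
    using Bernoulli_inequality[of "- x" n] \<open>x < 1\<close> assms by (intro mult_right_mono) auto
  also have "\<dots> = (1 - x\<^sup>2) ^ n"
    by (simp add: power_mult_distrib[symmetric] power2_eq_square algebra_simps)
  also have "\<dots> \<le> 1" using assms \<open>x < 1\<close> by (intro power_le_one) (auto simp: power_le_one)
  finally show ?thesis using assms by (simp add: field_simps)
qed simp

text \<open>The cost of the prime \<open>Suc n\<close> for \<open>\<delta> = 1/6\<close>, where
  \<open>1 / (1 - \<delta>) = 6/5\<close>, without the constant
  \<open>1 / (4 * \<delta> * (1 - \<delta>)) = 9/5\<close>.\<close>

definition tail_term :: "nat \<Rightarrow> nat \<Rightarrow> real" where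
  "tail_term y n = (if prime (Suc n) then euler_product y (6/5) n / (real n)\<^sup>2 else 0)"

lemma tail_term_nonneg: "0 \<le> tail_term y n"
  by (simp add: tail_term_def euler_product_nonneg)

section \<open>Growth of the Euler product over blocks of 210 integers\<close>

context
  fixes y k :: nat
  assumes k: "30 \<le> k" and y: "y < 210 * k"
begin

lemma not_prime_block_start: "\<not> prime (210 * k)"
  using k prime_product[of 210 k] by auto

text \<open>With \<open>u = p - 1\<close> the increment is \<open>3 / u + 2 / u\<^sup>2\<close>
  times \<open>6/5\<close>, and \<open>u \<ge> 210 * k\<close> because the first number of a block
  is composite.\<close>

lemma local_factor_block_le:
  assumes "prime p" "210 * k \<le> p"
  shows "local_factor y (6/5) p \<le> 1 + (6/5) * (3 / (210 * real k) + 2 / (210 * real k)\<^sup>2)"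
proof -
  have "p \<noteq> 210 * k" using assms(1) not_prime_block_start by blast
  then have "210 * k + 1 \<le> p" using assms(2) by simp
  then have "real (210 * k + 1) \<le> real p" by (simp only: of_nat_le_iff)
  then have p: "210 * real k \<le> real p - 1" by simp
  define u where "u = real p - 1"
  have u: "0 < u" "210 * real k \<le> u" using p k by (auto simp: u_def)
  have "(3 * real p - 1) / (real p - 1)\<^sup>2 = 3 / u + 2 / u\<^sup>2"
    using u(1) by (simp add: u_def[symmetric] field_simps power2_eq_square) (simp add: u_def algebra_simps)
  also have "\<dots> \<le> 3 / (210 * real k) + 2 / (210 * real k)\<^sup>2"
    using u k by (intro add_mono divide_left_mono power_mono mult_pos_pos) auto
  finally have "(6/5) * ((3 * real p - 1) / (real p - 1)\<^sup>2) \<le> (6/5) * (3 / (210 * real k) + 2 / (210 * real k)\<^sup>2)"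
    by (rule mult_left_mono) simp
  moreover have "local_factor y (6/5) p = 1 + (6/5) * ((3 * real p - 1) / (real p - 1)\<^sup>2)"
    using assms y by (simp add: local_factor_def)
  ultimately show ?thesis by (simp only: add_le_cancel_left)
qed

lemma euler_product_block_le:
  assumes "210 * k - 1 \<le> n" "n < 210 * k + 210"
  shows "euler_product y (6/5) n \<le> euler_product y (6/5) (210 * k - 1) * (real k / (real k - 0.824))"
proof -
  let ?x = "(6/5) * (3 / (210 * real k) + 2 / (210 * real k)\<^sup>2)"
  let ?B = "{p. prime p \<and> 210 * k \<le> p \<and> p \<le> n}"
  have split: "{p. prime p \<and> p \<le> n} = {p. prime p \<and> p \<le> 210 * k - 1} \<union> ?B"
    using assms k by auto
  have "card ?B \<le> card {p. prime p \<and> 210 * k \<le> p \<and> p < 210 * k + 210}"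
    using assms by (intro card_mono) auto
  then have card: "card ?B \<le> 48" using card_primes_block_le[of k] k by simp
  have kk: "real k \<ge> 30" using k by simp
  \<comment> \<open>Here \<open>57.6 = 48 * 6/5\<close>. At \<open>k = 30\<close> the numerator
    \<open>57.6 / 210 * (3 + 2 / 6300)\<close> is about 0.823, which leads to the constant
    \<open>0.824\<close>.\<close>
  have "48 * ?x = (57.6 / 210) * (3 + 2 / (210 * real k)) / real k"
    using kk by (simp add: field_simps power2_eq_square)
  also have "\<dots> \<le> 0.824 / real k"
  proof -
    have "2 / (210 * real k) \<le> 2 / (210 * 30)" using kk by (intro divide_left_mono) auto
    moreover have "57.6 / 210 * (3 + q) \<le> 0.824" if "q \<le> 2 / (210 * 30)" for q :: real
      using that by simp
    ultimately have "57.6 / 210 * (3 + 2 / (210 * real k)) \<le> 0.824" by blast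
    then show ?thesis by (rule divide_right_mono) simp
  qed
  finally have x48: "48 * ?x \<le> 0.824 / real k" .
  have "0.824 / real k < 1" using kk by simp
  have "(\<Prod>p\<in>?B. local_factor y (6/5) p) \<le> (\<Prod>p\<in>?B. 1 + ?x)"
    using local_factor_block_le order.trans[OF zero_le_one local_factor_ge_1]
    by (intro prod_mono) (auto simp: prime_gt_0_nat)
  also have "\<dots> = (1 + ?x) ^ card ?B" by simp
  also have "\<dots> \<le> (1 + ?x) ^ 48" using card by (intro power_increasing) auto
  also have "\<dots> \<le> 1 / (1 - real 48 * ?x)"
    using x48 \<open>0.824 / real k < 1\<close> by (intro power_one_plus_le) auto
  also have "\<dots> \<le> 1 / (1 - 0.824 / real k)"
    using x48 \<open>0.824 / real k < 1\<close> by (intro divide_left_mono mult_pos_pos) auto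
  also have "\<dots> = real k / (real k - 0.824)" using kk by (simp add: field_simps)
  finally have le: "(\<Prod>p\<in>?B. local_factor y (6/5) p) \<le> real k / (real k - 0.824)" .
  have eq: "euler_product y (6/5) n = euler_product y (6/5) (210 * k - 1) * (\<Prod>p\<in>?B. local_factor y (6/5) p)"
    unfolding euler_product_def split using k by (intro prod.union_disjoint) auto
  show ?thesis unfolding eq by (rule mult_left_mono[OF le]) (simp add: euler_product_nonneg)
qed

text \<open>The right-hand side is a potential that decreases from block to block by at least the block's share of the tail:
  blocks of 210 integers contain at most \<open>48 = totient 210\<close> primes, so the product grows like \<open>k powr 0.823\<close>, slower than \<open>k\<close>.\<close>

lemma tail_block_le:
  "(\<Sum>n\<in>{210 * k - 1..<210 * k + 209}. tail_term y n) + 0.0062 * euler_product y (6/5) (210 * k + 209) / real k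
     \<le> 0.0062 * euler_product y (6/5) (210 * k - 1) / (real k - 1)"
proof -
  let ?U = "euler_product y (6/5) (210 * k - 1)"
  let ?G = "real k / (real k - 0.824)"
  let ?I = "{210 * k - 1..<210 * k + 209}"
  have kk: "real k \<ge> 30" using k by simp
  have "(\<Sum>n\<in>?I. tail_term y n) \<le> (\<Sum>n\<in>?I. if prime (Suc n) then ?U * ?G / (210 * real k)\<^sup>2 else 0)"
  proof (rule sum_mono)
    fix n assume n: "n \<in> ?I"
    show "tail_term y n \<le> (if prime (Suc n) then ?U * ?G / (210 * real k)\<^sup>2 else 0)"
    proof (cases "prime (Suc n)")
      case True
      \<comment> \<open>The first index \<open>210 * k - 1\<close> belongs to the composite number
        \<open>210 * k\<close>, so every contributing denominator is at least
        \<open>(210 * k)\<^sup>2\<close>.\<close>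
      have "Suc n \<noteq> 210 * k" using True not_prime_block_start by metis
      then have "210 * k \<le> n" using n k by auto
      then have "210 * real k \<le> real n" by (metis of_nat_le_iff of_nat_mult of_nat_numeral)
      then have "euler_product y (6/5) n / (real n)\<^sup>2 \<le> ?U * ?G / (210 * real k)\<^sup>2"
        using n kk by (intro frac_le euler_product_block_le power_mono mult_nonneg_nonneg euler_product_nonneg) auto
      then show ?thesis using True by (simp add: tail_term_def)
    qed (simp add: tail_term_def)
  qed
  also have "\<dots> = real (card {n\<in>?I. prime (Suc n)}) * (?U * ?G / (210 * real k)\<^sup>2)"
    by (simp add: sum.If_cases Int_def)
  also have "\<dots> \<le> 48 * (?U * ?G / (210 * real k)\<^sup>2)"
  proof (rule mult_right_mono)
    have "card {n\<in>?I. prime (Suc n)} = card (Suc ` {n\<in>?I. prime (Suc n)})" by (simp add: card_image)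
    also have "\<dots> \<le> card {p. prime p \<and> 210 * k \<le> p \<and> p < 210 * k + 210}"
      by (intro card_mono) auto
    finally show "real (card {n\<in>?I. prime (Suc n)}) \<le> 48" using card_primes_block_le[of k] k by simp
  qed (use kk in \<open>simp add: euler_product_nonneg\<close>)
  also have "48 * (u * g / z) = u * (g * (48 / z))" for u g z :: real by simp
  finally have "(\<Sum>n\<in>?I. tail_term y n) \<le> ?U * (?G * (48 / (210 * real k)\<^sup>2))" .
  moreover have "0.0062 * euler_product y (6/5) (210 * k + 209) / real k \<le> 0.0062 * (?U * ?G) / real k"
    using kk by (intro divide_right_mono mult_left_mono euler_product_block_le) auto
  moreover have "?U * (?G * (48 / (210 * real k)\<^sup>2)) + 0.0062 * (?U * ?G) / real k
      \<le> 0.0062 * ?U / (real k - 1)"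
  proof -
    have clear: "x / w * (48 / (210 * x)\<^sup>2) + 0.0062 * (x / w) / x = (48 / 44100 / x + 0.0062) / w"
      if "x \<noteq> 0" "w \<noteq> 0" for x w :: real
      using that by (simp add: field_simps power2_eq_square)
    have "?G * (48 / (210 * real k)\<^sup>2) + 0.0062 * ?G / real k
       = (48 / 44100 / real k + 0.0062) / (real k - 0.824)"
      by (rule clear) (use kk in auto)
    also have "\<dots> \<le> 0.0062 / (real k - 1)"
    proof -
      have cross: "a / w \<le> b / z" if "a * z \<le> b * w" "0 < w" "0 < z" for a b w z :: real
        using that by (simp add: field_simps)
      \<comment> \<open>This determines \<open>0.0062\<close>: what is needed is
        \<open>48 / 44100 \<le> 0.0062 * (1 - 0.824)\<close>, where
        \<open>44100 = 210 ^ 2\<close>.\<close>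
      have "48 / 44100 / real k * (real k - 1) \<le> 48 / 44100" using kk by (simp add: field_simps)
      then have "(48 / 44100 / real k + 0.0062) * (real k - 1) \<le> 0.0062 * (real k - 0.824)"
        by (simp only: distrib_right) (simp add: right_diff_distrib)
      then show ?thesis using kk by (intro cross) auto
    qed
    finally have "?U * (?G * (48 / (210 * real k)\<^sup>2) + 0.0062 * ?G / real k) \<le> ?U * (0.0062 / (real k - 1))"
      by (intro mult_left_mono euler_product_nonneg) auto
    then show ?thesis by (simp add: algebra_simps)
  qed
  ultimately show ?thesis by linarith
qed

end

text \<open>The block inequalities telescope, starting at \<open>k = 30\<close> because
  \<open>6300 = 210 * 30\<close>; the range up to \<open>L\<close> is extended to \<open>L\<close>
  whole blocks.\<close>

lemma tail_sum_le:
  "(\<Sum>n\<in>{6299..<L}. tail_term 6299 n) \<le> 0.0062 * euler_product 6299 (6/5) 6299 / 29"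
proof -
  have blocks: "(\<Sum>n\<in>{6299..<6299 + 210 * j}. tail_term 6299 n)
      + 0.0062 * euler_product 6299 (6/5) (6299 + 210 * j) / (29 + real j)
      \<le> 0.0062 * euler_product 6299 (6/5) 6299 / 29" for j
  proof (induction j)
    case (Suc j)
    have eq: "210 * (30 + j) - 1 = 6299 + 210 * j" "210 * (30 + j) + 209 = 6299 + 210 * Suc j"
      "real (30 + j) - 1 = 29 + real j" "real (30 + j) = 29 + real (Suc j)" by auto
    have "(\<Sum>n\<in>{6299..<6299 + 210 * Suc j}. tail_term 6299 n)
       = (\<Sum>n\<in>{6299..<6299 + 210 * j}. tail_term 6299 n)
        + (\<Sum>n\<in>{6299 + 210 * j..<6299 + 210 * Suc j}. tail_term 6299 n)"
      by (rule sum.atLeastLessThan_concat[symmetric]) auto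
    moreover have "(\<Sum>n\<in>{6299 + 210 * j..<6299 + 210 * Suc j}. tail_term 6299 n)
        + 0.0062 * euler_product 6299 (6/5) (6299 + 210 * Suc j) / (29 + real (Suc j))
        \<le> 0.0062 * euler_product 6299 (6/5) (6299 + 210 * j) / (29 + real j)"
      using tail_block_le[of "30 + j" 6299] unfolding eq by simp
    ultimately show ?case using Suc.IH by linarith
  qed simp
  have "(\<Sum>n\<in>{6299..<L}. tail_term 6299 n) \<le> (\<Sum>n\<in>{6299..<6299 + 210 * L}. tail_term 6299 n)"
    by (intro sum_mono2 tail_term_nonneg) auto
  moreover have "0 \<le> 0.0062 * euler_product 6299 (6/5) (6299 + 210 * L) / (29 + real L)"
    by (simp add: euler_product_nonneg)
  ultimately show ?thesis using blocks[of L] by linarith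
qed

section \<open>Products over the primes below 6300\<close>

text \<open>Errs only towards acceptance: with trial divisors above 1 every prime passes, and a
  composite that passed would merely enlarge the bounds.\<close>

fun trial_division :: "int list \<Rightarrow> int \<Rightarrow> bool" where
  "trial_division [] n = True"
| "trial_division (q # qs) n =
     (if n mod q = 0 then n = q else if n < q * q then True else trial_division qs n)"

lemma trial_division_prime:
  assumes "prime n" "\<forall>q\<in>set qs. 1 < q"
  shows "trial_division qs n"
  using assms(2)
proof (induction qs)
  case (Cons q qs)
  have "n = q" if "n mod q = 0"
    using that assms(1) Cons.prems
    by (metis dvd_eq_mod_eq_0 list.set_intros(1) not_less order.strict_trans prime_int_iff zero_less_one order_le_less)
  with Cons show ?case by auto
qed simp

text \<open>These suffice to recognise all primes below \<open>83\<^sup>2 = 6889\<close>.\<close>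

definition small_primes :: "int list" where
  "small_primes = [2, 3, 5, 7, 11, 13, 17, 19, 23, 29, 31, 37, 41, 43, 47, 53, 59, 61, 67, 71, 73, 79]"

text \<open>Runs through \<open>[n, m)\<close>, multiplying \<open>A\<close> by \<open>p * (p + 1) / (p - 1)\<^sup>2\<close> and \<open>R\<close> by an upper bound for
  \<open>1 / (1 - p powr (- 2/3))\<close> at every candidate prime, rounding up in integer arithmetic. The bound comes from
  \<open>root 3 p \<le> (2 * s ^ 3 + p) / (3 * s\<^sup>2)\<close>, which holds for every \<open>s > 0\<close> and is sharp for \<open>s\<close> near \<open>root 3 p\<close>.\<close>

function sweep :: "int \<Rightarrow> int \<Rightarrow> int \<Rightarrow> int \<Rightarrow> int \<Rightarrow> int \<times> int" where
  "sweep n m s A R =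
     (if m \<le> n then (A, R)
      else if trial_division small_primes n
      then sweep (n + 1) m (if s ^ 3 \<le> n then s + 1 else s)
        (A * (n * (n + 1)) div (n - 1) ^ 2 + 1)
        (R * (3 * s ^ 2 * n) div (3 * s ^ 2 * n - 2 * s ^ 3 - n) + 1)
      else sweep (n + 1) m (if s ^ 3 \<le> n then s + 1 else s) A R)"
  by auto
termination by (relation "measure (\<lambda>(n, m, _). nat (m - n))") auto

declare sweep.simps [simp del]

text \<open>Fixed-point bounds with scale \<open>10 ^ 6\<close>, for the undistorted local factors
  and for the factors of Rankin's trick.\<close>

definition product_bounds :: "int \<Rightarrow> int \<Rightarrow> int \<Rightarrow> bool" where
  "product_bounds n A R \<longleftrightarrow>
     10 ^ 6 * (\<Prod>p | prime (p::nat) \<and> int p < n. 1 + (3 * real p - 1) / (real p - 1)\<^sup>2) \<le> of_int A \<and>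
     10 ^ 6 * (\<Prod>p | prime (p::nat) \<and> int p < n. 1 / (1 - root 3 p / p)) \<le> of_int R"

lemma le_div_plus_1:
  fixes a b :: int
  assumes "b > 0" "x \<le> real_of_int a / real_of_int b"
  shows "x \<le> real_of_int (a div b + 1)"
proof -
  have "real_of_int a / real_of_int b \<le> real_of_int (a div b + 1)"
    using assms(1) by (metis floor_divide_of_int_eq less_imp_le of_int_1 of_int_add real_of_int_floor_add_one_gt)
  then show ?thesis using assms(2) by linarith
qed

text \<open>Multiplying by a ratio of at least 1 and rounding up never lowers a bound; this handles
  composites that pass the trial division.\<close>

lemma le_mult_div_plus_1:
  fixes a b d :: int
  assumes "0 \<le> a" "0 < d" "d \<le> b"
  shows "a \<le> a * b div d + 1"
proof -
  have "a * d div d \<le> a * b div d" using assms by (intro zdiv_mono1 mult_left_mono) auto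
  then show ?thesis using assms by simp
qed

text \<open>The tangent of the concave cube root at \<open>s ^ 3\<close>; for
  \<open>c = root 3 x\<close> it amounts to
  \<open>(c - s)\<^sup>2 * (c + 2 * s) \<ge> 0\<close>.\<close>

lemma cube_root_le:
  fixes s x :: real
  assumes "0 < s" "0 \<le> x"
  shows "3 * s\<^sup>2 * root 3 x \<le> 2 * s ^ 3 + x"
proof -
  define c where "c = root 3 x"
  have c: "c \<ge> 0" "c ^ 3 = x" using assms by (auto simp: c_def)
  have "0 \<le> (c - s)\<^sup>2 * (c + 2 * s)" using assms c by simp
  also have "\<dots> = 2 * s ^ 3 + c ^ 3 - 3 * s\<^sup>2 * c" by (simp add: power2_eq_square power3_eq_cube algebra_simps)
  finally show ?thesis using c by (simp add: c_def)
qed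

lemma product_bounds_step:
  assumes "product_bounds n A R" "prime n" "2 \<le> s" "s \<le> n" "0 \<le> A" "0 \<le> R"
  shows "product_bounds (n + 1) (A * (n * (n + 1)) div (n - 1) ^ 2 + 1)
     (R * (3 * s ^ 2 * n) div (3 * s ^ 2 * n - 2 * s ^ 3 - n) + 1)"
proof -
  obtain p where p: "n = int p" "prime p" using assms(2) by (metis prime_gt_0_int int_nat_eq prime_int_nat_transfer less_imp_le zero_less_imp_eq_int)
  have set: "{q. prime q \<and> int q < n + 1} = insert p {q. prime q \<and> int q < n}" using p by auto
  have fin: "finite {q. prime q \<and> int q < n}" by (rule finite_subset[of _ "{..<p}"]) (auto simp: p)
  have p2: "real p \<ge> 2" using assms p by simp
  have s: "real_of_int s \<ge> 2" "real_of_int s \<le> real p" using assms p by auto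
  let ?den = "3 * s\<^sup>2 * n - 2 * s ^ 3 - n"
  \<comment> \<open>A form of the denominator in which positivity is visible for
    \<open>2 \<le> s \<le> n\<close>.\<close>
  have "0 < 2 * s\<^sup>2 * (n - s) + n * (s\<^sup>2 - 1)"
    using assms by (intro add_nonneg_pos mult_pos_pos mult_nonneg_nonneg) (auto simp: one_less_power)
  also have "\<dots> = ?den" by (simp add: power2_eq_square power3_eq_cube algebra_simps)
  finally have den: "0 < ?den" .
  have first: "1 + (3 * real p - 1) / (real p - 1)\<^sup>2 = real_of_int (n * (n + 1)) / real_of_int ((n - 1) ^ 2)"
  proof -
    have "1 + (3 * real p - 1) / (real p - 1)\<^sup>2 = ((real p - 1)\<^sup>2 + (3 * real p - 1)) / (real p - 1)\<^sup>2"
      using p2 by (simp add: add_divide_distrib)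
    also have "(real p - 1)\<^sup>2 + (3 * real p - 1) = real p * (real p + 1)"
      by (simp add: power2_eq_square algebra_simps)
    finally show ?thesis by (simp add: p(1))
  qed
  have second: "1 / (1 - root 3 p / p) \<le> real_of_int (3 * s\<^sup>2 * n) / real_of_int ?den"
  proof -
    have "real_of_int ?den = 3 * (real_of_int s)\<^sup>2 * real p - (2 * real_of_int s ^ 3 + real p)" by (simp add: p)
    also have "\<dots> \<le> 3 * (real_of_int s)\<^sup>2 * real p - 3 * (real_of_int s)\<^sup>2 * root 3 p"
      using cube_root_le[of "real_of_int s" "real p"] s by simp
    finally have le: "real_of_int ?den \<le> 3 * (real_of_int s)\<^sup>2 * (real p - root 3 p)" by (simp add: algebra_simps)
    have "1 / (1 - root 3 p / p) = real p / (real p - root 3 p)"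
      using p2 by (simp add: field_simps)
    also have "\<dots> = 3 * (real_of_int s)\<^sup>2 * real p / (3 * (real_of_int s)\<^sup>2 * (real p - root 3 p))"
      using s by simp
    also have "\<dots> \<le> 3 * (real_of_int s)\<^sup>2 * real p / real_of_int ?den"
    proof (rule divide_left_mono[OF le])
      have "0 < real_of_int ?den" using den by (simp only: of_int_0_less_iff)
      then show "0 < 3 * (real_of_int s)\<^sup>2 * (real p - root 3 p) * real_of_int ?den"
        using le by (intro mult_pos_pos[of "3 * (real_of_int s)\<^sup>2 * (real p - root 3 p)"]) linarith+
    qed simp
    finally show ?thesis by (simp add: p)
  qed
  have "10 ^ 6 * (\<Prod>q | prime (q::nat) \<and> int q < n + 1. 1 + (3 * real q - 1) / (real q - 1)\<^sup>2)
     = 10 ^ 6 * (\<Prod>q | prime (q::nat) \<and> int q < n. 1 + (3 * real q - 1) / (real q - 1)\<^sup>2) * (1 + (3 * real p - 1) / (real p - 1)\<^sup>2)"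
    unfolding set using fin by (simp add: p)
  also have "\<dots> \<le> of_int A * (1 + (3 * real p - 1) / (real p - 1)\<^sup>2)"
    using assms(1) p2 by (intro mult_right_mono) (auto simp: product_bounds_def)
  also have "\<dots> = real_of_int (A * (n * (n + 1))) / real_of_int ((n - 1) ^ 2)" unfolding first by simp
  finally have 1: "10 ^ 6 * (\<Prod>q | prime (q::nat) \<and> int q < n + 1. 1 + (3 * real q - 1) / (real q - 1)\<^sup>2)
     \<le> of_int (A * (n * (n + 1)) div (n - 1) ^ 2 + 1)"
    by (intro le_div_plus_1) (use assms in auto)
  have "root 3 p \<le> real p"
    using p2 real_root_le_mono[of 3 "real p" "real p ^ 3"] power_increasing[of 1 3 "real p"]
    by (simp add: real_root_power_cancel)
  have "10 ^ 6 * (\<Prod>q | prime (q::nat) \<and> int q < n + 1. 1 / (1 - root 3 q / q))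
     = 10 ^ 6 * (\<Prod>q | prime (q::nat) \<and> int q < n. 1 / (1 - root 3 q / q)) * (1 / (1 - root 3 p / p))"
    unfolding set using fin by (simp add: p)
  also have "\<dots> \<le> of_int R * (1 / (1 - root 3 p / p))"
    using assms(1) p2 \<open>root 3 p \<le> real p\<close> by (intro mult_right_mono) (auto simp: product_bounds_def)
  also have "\<dots> \<le> of_int R * (real_of_int (3 * s\<^sup>2 * n) / real_of_int ?den)"
    using assms by (intro mult_left_mono second) auto
  finally have 2: "10 ^ 6 * (\<Prod>q | prime (q::nat) \<and> int q < n + 1. 1 / (1 - root 3 q / q))
     \<le> of_int (R * (3 * s ^ 2 * n) div ?den + 1)"
    by (intro le_div_plus_1 den) simp
  from 1 2 show ?thesis by (simp add: product_bounds_def)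
qed

text \<open>Soundness rests on the invariant \<open>2 \<le> s \<le> n\<close>; how close
  \<open>s ^ 3\<close> is to \<open>n\<close> affects only the sharpness.\<close>

lemma product_bounds_sweep:
  assumes "product_bounds n A R" "2 \<le> s" "s \<le> n" "n \<le> m" "0 \<le> A" "0 \<le> R"
    and "sweep n m s A R = (A', R')"
  shows "product_bounds m A' R'"
  using assms
proof (induction n m s A R rule: sweep.induct)
  case (1 n m s A R)
  let ?s = "if s ^ 3 \<le> n then s + 1 else s"
  have s: "2 \<le> ?s" "?s \<le> n + 1" using "1.prems" by auto
  show ?case
  proof (cases "n = m")
    case True
    then show ?thesis using "1.prems" by (simp add: sweep.simps[of m])
  next
    case False
    then have "\<not> m \<le> n" using "1.prems" by simp
    show ?thesis
    proof (cases "trial_division small_primes n")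
      case trial: True
      let ?A = "A * (n * (n + 1)) div (n - 1) ^ 2 + 1"
      let ?R = "R * (3 * s ^ 2 * n) div (3 * s ^ 2 * n - 2 * s ^ 3 - n) + 1"
      have "0 < 2 * s\<^sup>2 * (n - s) + n * (s\<^sup>2 - 1)"
        using "1.prems" by (intro add_nonneg_pos mult_pos_pos mult_nonneg_nonneg) (auto simp: one_less_power)
      also have "\<dots> = 3 * s\<^sup>2 * n - 2 * s ^ 3 - n" by (simp add: power2_eq_square power3_eq_cube algebra_simps)
      finally have den: "0 < 3 * s\<^sup>2 * n - 2 * s ^ 3 - n" .
      have "A \<le> ?A"
      proof (rule le_mult_div_plus_1)
        show "(n - 1)\<^sup>2 \<le> n * (n + 1)" using "1.prems" by (simp add: power2_eq_square algebra_simps)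
      qed (use "1.prems" in auto)
      moreover have "R \<le> ?R"
      proof (rule le_mult_div_plus_1[OF _ den])
        have "0 \<le> s ^ 3" "0 \<le> n" using "1.prems" by auto
        then show "3 * s\<^sup>2 * n - 2 * s ^ 3 - n \<le> 3 * s\<^sup>2 * n" by linarith
      qed (use "1.prems" in auto)
      ultimately have nonneg: "A \<le> ?A" "R \<le> ?R" by auto
      have "product_bounds (n + 1) ?A ?R"
      proof (cases "prime n")
        case True
        then show ?thesis using "1.prems" by (intro product_bounds_step)
      next
        case False
        then have "{q. prime q \<and> int q < n + 1} = {q. prime q \<and> int q < n}"
          by (auto simp: order_le_less)
        then have "product_bounds (n + 1) A R" using "1.prems"(1) by (simp add: product_bounds_def)
        then show ?thesis using nonneg unfolding product_bounds_def by (meson of_int_le_iff order_trans)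
      qed
      then show ?thesis
        using "1.IH"(1)[OF \<open>\<not> m \<le> n\<close> trial] s nonneg "1.prems" \<open>\<not> m \<le> n\<close> trial
        by (simp add: sweep.simps[of n])
    next
      case trial: False
      then have "\<not> prime n" using trial_division_prime[of n small_primes] by (auto simp: small_primes_def)
      then have "{q. prime q \<and> int q < n + 1} = {q. prime q \<and> int q < n}"
        by (auto simp: order_le_less)
      then have "product_bounds (n + 1) A R" using "1.prems"(1) by (simp add: product_bounds_def)
      then show ?thesis
        using "1.IH"(2)[OF \<open>\<not> m \<le> n\<close> trial] s "1.prems" \<open>\<not> m \<le> n\<close> trial
        by (simp add: sweep.simps[of n])
    qed
  qed
qed

text \<open>Each piece resumes with the previous results and with \<open>s\<close> the ceiling of
  the cube root of its first number. After unscaling, the final bounds are about 2309.9 and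
  55882.\<close>

lemma sweep_values:
  "sweep 2 2000 2 1000000 1000000 = (1520465520, 6589390160)"
  "sweep 2000 3500 13 1520465520 6589390160 = (1874512361, 17360159806)"
  "sweep 3500 4500 16 1874512361 17360159806 = (2054401406, 28185582246)"
  "sweep 4500 5500 17 2054401406 28185582246 = (2201811054, 41853429448)"
  "sweep 5500 6300 18 2201811054 41853429448 = (2309892281, 55882217648)"
  by code_simp+

lemma product_bounds_6300: "product_bounds 6300 2309892281 55882217648"
proof -
  have "{p::nat. prime p \<and> int p < 2} = {}" by (auto dest: prime_ge_2_nat)
  then have "product_bounds 2 1000000 1000000" by (simp only: product_bounds_def prod.empty) simp
  from product_bounds_sweep[OF this _ _ _ _ _ sweep_values(1)]
  have "product_bounds 2000 1520465520 6589390160" by simp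
  from product_bounds_sweep[OF this _ _ _ _ _ sweep_values(2)]
  have "product_bounds 3500 1874512361 17360159806" by simp
  from product_bounds_sweep[OF this _ _ _ _ _ sweep_values(3)]
  have "product_bounds 4500 2054401406 28185582246" by simp
  from product_bounds_sweep[OF this _ _ _ _ _ sweep_values(4)]
  have "product_bounds 5500 2201811054 41853429448" by simp
  from product_bounds_sweep[OF this _ _ _ _ _ sweep_values(5)]
  show ?thesis by simp
qed

section \<open>The minimum modulus\<close>

theorem theorem1:
  fixes k :: nat and m :: "nat \<Rightarrow> nat" and a :: "nat \<Rightarrow> int"
  assumes "k \<ge> 1"
    and "1 < m 1"
    and "strict_mono_on {1..k} m"
    and "\<forall>z::int. \<exists>j\<in>{1..k}. [z = a j] (mod int (m j))"
  shows "m 1 \<le> 10 ^ 18"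
proof (rule ccontr)
  assume large: "\<not> m 1 \<le> 10 ^ 18"
  define D where "D = m ` {1..k}"
  have inj: "inj_on m {1..k}" using assms(3) by (rule strict_mono_on_imp_inj_on)
  define r where "r d = a (the_inv_into {1..k} m d)" for d
  have r: "r (m j) = a j" if "j \<in> {1..k}" for j
    using the_inv_into_f_f[OF inj that] by (simp add: r_def)
  have D_large: "10 ^ 18 < d" if d: "d \<in> D" for d
  proof -
    obtain j where j: "j \<in> {1..k}" "d = m j" using d by (auto simp: D_def)
    have "m 1 \<le> m j" using assms(1) j strict_mono_on_leD[OF assms(3), of 1 j] by auto
    then show ?thesis using large j by linarith
  qed
  define c where "c = Max D"
  have c: "0 < d" "d \<le> c" if "d \<in> D" for d
    using that D_large[OF that] by (auto simp: c_def D_def)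
  \<comment> \<open>Large enough to exceed both every modulus and the threshold 6299;
    \<open>c\<close> itself bounds all multiplicities.\<close>
  define L where "L = c + 6299"
  interpret residue_classes D r c 6299 "1/6"
    by unfold_locales (auto simp: D_def)
  let ?S = "{d\<in>D. d dvd K 6299}"
  have theta: "1 / (1 - 1 / 6) = (6 / 5 :: real)" by simp
  have "1 \<le> (\<Sum>d\<in>?S. 1 / real d)
     + (\<Sum>n\<in>{6299..<L}. if prime (Suc n) then euler_product 6299 (1 / (1 - 1/6)) n / (real n)\<^sup>2 else 0)
        / (4 * (1/6) * (1 - 1/6))"
  proof (rule covering_bound)
    fix x
    obtain j where j: "j \<in> {1..k}" "[x = a j] (mod int (m j))" using assms(4) by blast
    then show "\<exists>d\<in>D. [x = r d] (mod int d)" using r[OF j(1)] by (intro bexI[of _ "m j"]) (auto simp: D_def)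
  next
    fix d assume "d \<in> D"
    then show "d dvd K L" using c[of d] by (intro dvd_smooth_part) (auto simp: L_def)
  qed (simp add: L_def)
  then have one: "1 \<le> (\<Sum>d\<in>?S. 1 / real d) + (\<Sum>n\<in>{6299..<L}. tail_term 6299 n) / (5/9)"
    unfolding theta by (simp add: tail_term_def)
  have primes_eq: "{p::nat. prime p \<and> int p < 6300} = {p. prime p \<and> p \<le> 6299}" by auto
  have "euler_product 6299 (6/5) 6299 = (\<Prod>p | prime (p::nat) \<and> int p < 6300. 1 + (3 * real p - 1) / (real p - 1)\<^sup>2)"
    unfolding euler_product_def primes_eq by (intro prod.cong refl) (simp add: local_factor_def)
  then have euler: "euler_product 6299 (6/5) 6299 \<le> 2309.9"
    using product_bounds_6300 by (simp add: product_bounds_def)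
  text \<open>Rankin's trick with exponent 1/3: every modulus exceeds \<open>(10 ^ 6) ^ 3\<close>.\<close>
  have "(\<Sum>d\<in>?S. 1 / real d) \<le> (\<Sum>d\<in>?S. (root 3 d / d) / 10 ^ 6)"
  proof (rule sum_mono)
    fix d assume "d \<in> ?S"
    then have "10 ^ 18 < d" using D_large by simp
    then have d: "(10 ^ 6) ^ 3 \<le> real d" by simp
    have "root 3 ((10 ^ 6) ^ 3) \<le> root 3 d" using d by (rule real_root_le_mono[rotated]) simp
    then have "10 ^ 6 \<le> root 3 d" by (simp add: real_root_power_cancel del: power_mult)
    moreover have "0 < real d" using d by simp
    ultimately show "1 / real d \<le> (root 3 d / d) / 10 ^ 6" by (simp add: field_simps)
  qed
  also have "\<dots> \<le> (\<Sum>d | d dvd K 6299. (root 3 d / d) / 10 ^ 6)"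
    by (intro sum_mono2 finite_divisors smooth_part_pos) auto
  also have "\<dots> = (\<Sum>d | d dvd K 6299. root 3 d / d) / 10 ^ 6" by (rule sum_divide_distrib[symmetric])
  also have "\<dots> \<le> (\<Prod>p | prime (p::nat) \<and> p \<le> 6299. 1 / (1 - root 3 p / p)) / 10 ^ 6"
    by (intro divide_right_mono sum_root_divisors_le) simp
  also have "\<dots> \<le> 0.056"
    using product_bounds_6300 unfolding product_bounds_def primes_eq by simp
  finally have "(\<Sum>d\<in>?S. 1 / real d) \<le> 0.056" .
  moreover have "(\<Sum>n\<in>{6299..<L}. tail_term 6299 n) \<le> 0.0062 * 2309.9 / 29"
    using tail_sum_le[of L] euler by simp
  \<comment> \<open>The total is at most \<open>0.056 + 9/5 * 0.494\<close>, which is below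
    0.95.\<close>
  ultimately show False using one by simp
qed

end
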